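(* Let $1\le p\le\infty$, $p\neq 2$, and suppose that $X$ is an Asymptotic-$\ell_p$ space. Then no subspace $Y$ of $X$ admits an equivalent almost transitive norm.
   Context: Banach spaces are infinite-dimensional, real or complex, and "subspace" means closed infinite-dimensional linear subspace. A norm on $Y$ is almost transitive if for every $y$ in the unit sphere of $Y$ the orbit of $y$ under the group of surjective linear isometries of $Y$ (for that norm) is norm dense in the unit sphere. Asymptotic structure: let $X$ have a normalized Schauder basis $(e_i)$. For $x=\sum_i c_ie_i$, $\operatorname{supp}x=\{i:c_i\ne0\}$, and $x>m$ means $\operatorname{supp}x\subset[m+1,\infty)$. A basis $(b_i)_{i=1}^n$ of unit vectors of an $n$-dimensional normed space belongs to $\{X,(e_i)\}_n$ if for every $\varepsilon>0$: $\forall m_1\,\exists x_1>m_1\ \forall m_2\,\exists x_2>m_2\ \dots\ \forall m_n\,\exists x_n>m_n$ (with $x_i\in X$) such that there exist $0<c\le C$ with $C/c<1+\varepsilon$ and $c\|\sum_{i=1}^n a_ib_i\|\le\|\sum_{i=1}^n a_ix_i\|\le C\|\sum_{i=1}^n a_ib_i\|$ for all scalars $(a_i)_{i=1}^n$. A Banach space $X$ with a normalized Schauder basis $(e_i)$ is an Asymptotic-$\ell_p$ space if there exists $C>0$ such that for all $n\ge1$, all $(b_i)_{i=1}^n\in\{X,(e_i)\}_n$ and all scalars $(a_i)_{i=1}^n$, $\frac1C(\sum_{i=1}^n|a_i|^p)^{1/p}\le\|\sum_{i=1}^na_ib_i\|\le C(\sum_{i=1}^n|a_i|^p)^{1/p}$,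 where for $p=\infty$ the expression $(\sum|a_i|^p)^{1/p}$ is replaced by $\max_{1\le i\le n}|a_i|$. *)

theory Defs
  imports "HOL-Analysis.Analysis" "HOL-Library.Function_Algebras"
begin

text \<open>
  Real and complex Banach spaces are treated together. The scalar field is a type \<open>'k\<close> of sort
  \<open>{real_normed_field, euclidean_space}\<close>: by the Frobenius theorem its members are, up to
  isometric isomorphism, exactly \<open>real\<close> and \<open>complex\<close>, both of which are instances. The class
  \<open>banach\<close> supplies the complete norm and the real scalar multiplication; \<open>scl\<close> is the
  multiplication by scalars of \<open>'k\<close>. For \<open>'k = real\<close>, \<open>scl\<close> is \<open>scaleR\<close>.
\<close>

locale banach_over = vector_space scl
  for scl :: "'k::{real_normed_field, euclidean_space} \<Rightarrow> 'a::banach \<Rightarrow> 'a" +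
  assumes scl_of_real: "scl (of_real r) x = r *\<^sub>R x"
    and norm_scl: "norm (scl c x) = norm c * norm x"

text \<open>The ambient vector space of the next definition carries no norm of its own.\<close>

definition is_norm_on ::
  "('k::real_normed_field \<Rightarrow> 'b::ab_group_add \<Rightarrow> 'b) \<Rightarrow> 'b set \<Rightarrow> ('b \<Rightarrow> real) \<Rightarrow> bool" where
  "is_norm_on scl V N \<longleftrightarrow>
     (\<forall>x\<in>V. N x \<ge> 0) \<and>
     (\<forall>x\<in>V. N x = 0 \<longleftrightarrow> x = 0) \<and>
     (\<forall>c. \<forall>x\<in>V. N (scl c x) = norm c * N x) \<and>
     (\<forall>x\<in>V. \<forall>y\<in>V. N (x + y) \<le> N x + N y)"

definition closed_infdim_subspace ::
  "('k::field \<Rightarrow> 'a::banach \<Rightarrow> 'a) \<Rightarrow> 'a set \<Rightarrow> bool" where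
  "closed_infdim_subspace scl Y \<longleftrightarrow>
     module.subspace scl Y \<and> closed Y \<and>
     \<not> (\<exists>B. finite B \<and> Y = module.span scl B)"

definition equivalent_norm_on ::
  "('k::real_normed_field \<Rightarrow> 'a::banach \<Rightarrow> 'a) \<Rightarrow> 'a set \<Rightarrow> ('a \<Rightarrow> real) \<Rightarrow> bool" where
  "equivalent_norm_on scl Y N \<longleftrightarrow>
     is_norm_on scl Y N \<and>
     (\<exists>c>0. \<exists>C>0. \<forall>y\<in>Y. c * norm y \<le> N y \<and> N y \<le> C * norm y)"

text \<open>The values outside \<open>Y\<close> of the members of the following set are irrelevant.\<close>

definition surj_lin_isometries ::
  "('k::field \<Rightarrow> 'b::ab_group_add \<Rightarrow> 'b) \<Rightarrow> 'b set \<Rightarrow> ('b \<Rightarrow> real) \<Rightarrow> ('b \<Rightarrow> 'b) set" where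
  "surj_lin_isometries scl Y N =
     {T. T ` Y = Y \<and>
         (\<forall>x\<in>Y. \<forall>y\<in>Y. T (x + y) = T x + T y) \<and>
         (\<forall>c. \<forall>x\<in>Y. T (scl c x) = scl c (T x)) \<and>
         (\<forall>x\<in>Y. N (T x) = N x)}"

definition almost_transitive ::
  "('k::field \<Rightarrow> 'b::ab_group_add \<Rightarrow> 'b) \<Rightarrow> 'b set \<Rightarrow> ('b \<Rightarrow> real) \<Rightarrow> bool" where
  "almost_transitive scl Y N \<longleftrightarrow>
     (\<forall>y\<in>Y. N y = 1 \<longrightarrow>
        (\<forall>z\<in>Y. N z = 1 \<longrightarrow>
           (\<forall>\<epsilon>>0. \<exists>T\<in>surj_lin_isometries scl Y N. N (T y - z) < \<epsilon>)))"

definition normalized_schauder_basis ::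
  "('k::field \<Rightarrow> 'a::banach \<Rightarrow> 'a) \<Rightarrow> (nat \<Rightarrow> 'a) \<Rightarrow> bool" where
  "normalized_schauder_basis scl e \<longleftrightarrow>
     (\<forall>i. norm (e i) = 1) \<and>
     (\<forall>x. \<exists>!c. (\<lambda>i. scl (c i) (e i)) sums x)"

definition basis_coord ::
  "('k::field \<Rightarrow> 'a::banach \<Rightarrow> 'a) \<Rightarrow> (nat \<Rightarrow> 'a) \<Rightarrow> 'a \<Rightarrow> nat \<Rightarrow> 'k" where
  "basis_coord scl e x = (THE c. (\<lambda>i. scl (c i) (e i)) sums x)"

definition basis_supp ::
  "('k::field \<Rightarrow> 'a::banach \<Rightarrow> 'a) \<Rightarrow> (nat \<Rightarrow> 'a) \<Rightarrow> 'a \<Rightarrow> nat set" where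
  "basis_supp scl e x = {i. basis_coord scl e x i \<noteq> 0}"

text \<open>
  \<open>x > m\<close>, i.e. none of the first \<open>m\<close> basis vectors occurs in \<open>x\<close>. The basis is indexed from
  \<open>0\<close>, so the support condition \<open>[m+1,\<infinity>)\<close> of the indexing from \<open>1\<close> becomes \<open>{m..}\<close>.
\<close>

definition beyond ::
  "('k::field \<Rightarrow> 'a::banach \<Rightarrow> 'a) \<Rightarrow> (nat \<Rightarrow> 'a) \<Rightarrow> nat \<Rightarrow> 'a \<Rightarrow> bool" where
  "beyond scl e m x \<longleftrightarrow> basis_supp scl e x \<subseteq> {m..}"

text \<open>
  \<open>asym_game scl e n P []\<close> is the alternating statement
  \<open>\<forall>m\<^sub>1. \<exists>x\<^sub>1 > m\<^sub>1. \<dots> \<forall>m\<^sub>n. \<exists>x\<^sub>n > m\<^sub>n. P [x\<^sub>1, \<dots>, x\<^sub>n]\<close>; the list argument collects the vectors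
  chosen so far.
\<close>

primrec asym_game ::
  "('k::field \<Rightarrow> 'a::banach \<Rightarrow> 'a) \<Rightarrow> (nat \<Rightarrow> 'a) \<Rightarrow> nat \<Rightarrow> ('a list \<Rightarrow> bool) \<Rightarrow> 'a list \<Rightarrow> bool" where
  "asym_game scl e 0 P xs = P xs"
| "asym_game scl e (Suc n) P xs =
     (\<forall>m. \<exists>x. beyond scl e m x \<and> asym_game scl e n P (xs @ [x]))"

text \<open>
  Membership of \<open>b 0, \<dots>, b (n-1)\<close> in the asymptotic structure \<open>{X,(e\<^sub>i)}\<^sub>n\<close>. The \<open>n\<close>-dimensional
  normed space of which they form a basis is their span, with the norm \<open>N\<close>, in a vector space with
  scalar multiplication \<open>sclF\<close>.
\<close>

definition in_asym_structure ::
  "('k::real_normed_field \<Rightarrow> 'a::banach \<Rightarrow> 'a) \<Rightarrow> (nat \<Rightarrow> 'a) \<Rightarrow> nat \<Rightarrow>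
   ('k \<Rightarrow> 'b::ab_group_add \<Rightarrow> 'b) \<Rightarrow> ('b \<Rightarrow> real) \<Rightarrow> (nat \<Rightarrow> 'b) \<Rightarrow> bool" where
  "in_asym_structure scl e n sclF N b \<longleftrightarrow>
     vector_space sclF \<and>
     inj_on b {..<n} \<and> \<not> module.dependent sclF (b ` {..<n}) \<and>
     is_norm_on sclF (module.span sclF (b ` {..<n})) N \<and>
     (\<forall>i<n. N (b i) = 1) \<and>
     (\<forall>\<epsilon>>0. asym_game scl e n
        (\<lambda>xs. \<exists>c C. 0 < c \<and> c \<le> C \<and> C / c < 1 + \<epsilon> \<and>
           (\<forall>a :: nat \<Rightarrow> 'k.
              c * N (\<Sum>i<n. sclF (a i) (b i)) \<le> norm (\<Sum>i<n. scl (a i) (xs ! i)) \<and>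
              norm (\<Sum>i<n. scl (a i) (xs ! i)) \<le> C * N (\<Sum>i<n. sclF (a i) (b i)))) [])"

definition lp_norm :: "ereal \<Rightarrow> nat \<Rightarrow> (nat \<Rightarrow> 'k::real_normed_field) \<Rightarrow> real" where
  "lp_norm p n a =
     (if p = \<infinity> then Max ((\<lambda>i. norm (a i)) ` {..<n})
      else (\<Sum>i<n. norm (a i) powr real_of_ereal p) powr (1 / real_of_ereal p))"

text \<open>
  The finite-dimensional normed spaces of the asymptotic structure are taken inside the space
  \<open>nat \<Rightarrow> 'k\<close> of scalar sequences with pointwise operations. This is no restriction: every
  finite-dimensional space over \<open>'k\<close> is linearly isomorphic to a subspace of it, and the norm is
  arbitrary.
\<close>

definition asymptotic_lp ::
  "('k::real_normed_field \<Rightarrow> 'a::banach \<Rightarrow> 'a) \<Rightarrow> (nat \<Rightarrow> 'a) \<Rightarrow> ereal \<Rightarrow> bool" where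
  "asymptotic_lp scl e p \<longleftrightarrow>
     normalized_schauder_basis scl e \<and>
     (\<exists>C>0. \<forall>n\<ge>1. \<forall>(N :: (nat \<Rightarrow> 'k) \<Rightarrow> real) (b :: nat \<Rightarrow> nat \<Rightarrow> 'k).
        in_asym_structure scl e n (\<lambda>c f j. c * f j) N b \<longrightarrow>
        (\<forall>a :: nat \<Rightarrow> 'k.
           1 / C * lp_norm p n a \<le> N (\<Sum>i<n. (\<lambda>j. a i * b i j)) \<and>
           N (\<Sum>i<n. (\<lambda>j. a i * b i j)) \<le> C * lp_norm p n a))"

end

(* Almost transitivity makes all directions of Y look alike, which is incompatible with the growth
   n^(1/p) of norms in asymptotic structures unless p = 2. Let p < 2. The asymptotic structure
   provides n vectors of Y that are uniformly equivalent to the basis of l_p^n. On their span E let a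
   multiple of the Euclidean norm of l_2^n dominate N and (almost) touch it at a unit vector y. A
   subspace of E of small codimension contains a vector z whose coordinates mostly have modulus 1, and
   on such z the Euclidean norm and N are comparable with constants that do not depend on n; hence
   N(r y + z)^2 <= r^2 + const for a suitable sign of z. An isometry of Y takes y close to any
   prescribed s / N(s), and z may be chosen so that its image lies beyond any m. Iterating from s = 0, the
   vector player in the asymptotic game obtains N(x_1 + ... + x_n)^2 <= const * n, whereas the
   asymptotic l_p estimate makes the left-hand side at least const * n^(2/p). For p > 2 all
   inequalities are reversed. *)

theory Submission
  imports Defs
begin

subsection \<open>Uniform boundedness of the basis projections\<close>

text \<open>The hypothesis bounds only members of the asymptotic structure, while the construction
  yields a strategy whose outcomes vary with the cutoffs. A member is recovered as a cluster point
  of the norms of the outcomes. For the limit to be a norm, these norms need a lower bound that is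
  uniform over all plays; it comes from the basis constant, which is extracted from unique
  expansions by a Baire argument. In a single round the obstacle is that neither the cutoff m nor
  the isometry T that moves y can be controlled, so no vector of E can be prepared in advance to
  have its image beyond m. For fixed T, however, this is a system of m linear equations for the
  coefficients, and E may be given dimension 2m + 1. Each equation spoils at most one coordinate, so
  at least half of them keep modulus 1. On such vectors Hoelder's comparison of the p-norm with the
  Euclidean norm is sharp up to a constant, though not on all of E. Since m is unbounded during the
  game, only estimates free of dim E give an increment that is the same in every round.\<close>

context banach_over
begin

lemma bounded_linear_scl: "bounded_linear (scl c)"
proof (rule bounded_linear_intro)
  show "scl c (r *\<^sub>R x) = r *\<^sub>R scl c x" for r x
    by (simp add: scl_of_real[symmetric] scale_left_commute)
  show "norm (scl c x) \<le> norm x * norm c" for x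
    by (simp add: norm_scl)
qed (rule scale_right_distrib)

lemma bounded_linear_scl_left: "bounded_linear (\<lambda>c. scl c x)"
proof (rule bounded_linear_intro)
  show "scl (r *\<^sub>R c) x = r *\<^sub>R scl c x" for r c
    by (simp add: scl_of_real[symmetric] scaleR_conv_of_real)
  show "norm (scl c x) \<le> norm c * norm x" for c
    by (simp add: norm_scl)
qed (rule scale_left_distrib)

lemma subspace_scaleR: "subspace Y \<Longrightarrow> x \<in> Y \<Longrightarrow> r *\<^sub>R x \<in> Y"
  by (metis scl_of_real subspace_scale)

end

locale schauder_space = banach_over scl
  for scl :: "'k::{real_normed_field, euclidean_space} \<Rightarrow> 'a::banach \<Rightarrow> 'a" +
  fixes e :: "nat \<Rightarrow> 'a"
  assumes basis: "normalized_schauder_basis scl e"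
begin

abbreviation coord :: "'a \<Rightarrow> nat \<Rightarrow> 'k" where
  "coord \<equiv> basis_coord scl e"

abbreviation proj :: "nat \<Rightarrow> 'a \<Rightarrow> 'a" where
  "proj m x \<equiv> (\<Sum>i<m. scl (coord x i) (e i))"

lemma norm_e: "norm (e i) = 1"
  using basis by (simp add: normalized_schauder_basis_def)

lemma ex1_coord: "\<exists>!c. (\<lambda>i. scl (c i) (e i)) sums x"
  using basis by (simp add: normalized_schauder_basis_def)

lemma sums_coord: "(\<lambda>i. scl (coord x i) (e i)) sums x"
  unfolding basis_coord_def by (rule theI'[OF ex1_coord])

lemma coord_eqI: "(\<lambda>i. scl (c i) (e i)) sums x \<Longrightarrow> coord x = c"
  using ex1_coord sums_coord by blast

lemma coord_add: "coord (x + y) i = coord x i + coord y i"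
proof -
  have "coord (x + y) = (\<lambda>i. coord x i + coord y i)"
    by (rule coord_eqI) (simp add: scale_left_distrib sums_add sums_coord)
  then show ?thesis by simp
qed

lemma coord_scl: "coord (scl c x) i = c * coord x i"
proof -
  have "(\<lambda>i. scl c (scl (coord x i) (e i))) sums scl c x"
    by (rule bounded_linear.sums[OF bounded_linear_scl sums_coord])
  then have "coord (scl c x) = (\<lambda>i. c * coord x i)"
    by (intro coord_eqI) simp
  then show ?thesis by simp
qed

lemma coord_0: "coord 0 i = 0"
  using coord_scl[of 0 0 i] by simp

lemma coord_diff: "coord (x - y) i = coord x i - coord y i"
  using coord_add[of "x - y" y i] by simp

lemma coord_sum: "coord (sum f A) i = (\<Sum>j\<in>A. coord (f j) i)"
  by (induction A rule: infinite_finite_induct) (auto simp: coord_0 coord_add)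

lemma proj_add: "proj m (x + y) = proj m x + proj m y"
  by (simp add: coord_add scale_left_distrib sum.distrib)

lemma proj_diff: "proj m (x - y) = proj m x - proj m y"
  by (simp add: coord_diff scale_left_diff_distrib sum_subtractf)

lemma proj_scl: "proj m (scl c x) = scl c (proj m x)"
  by (simp add: coord_scl scale_sum_right)

lemma proj_scaleR: "proj m (r *\<^sub>R x) = r *\<^sub>R proj m x"
  using proj_scl[of "of_real r" x m] by (simp add: scl_of_real)

lemma proj_tendsto: "(\<lambda>m. proj m x) \<longlonglongrightarrow> x"
  using sums_coord[of x] by (simp add: sums_def)

lemma norm_coord_le:
  assumes "\<And>m. norm (proj m x) \<le> B"
  shows "norm (coord x i) \<le> 2 * B"
proof -
  have "norm (coord x i) = norm (proj (Suc i) x - proj i x)"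
    by (simp add: norm_scl norm_e)
  also have "\<dots> \<le> norm (proj (Suc i) x) + norm (proj i x)"
    by (rule norm_triangle_ineq4)
  finally show ?thesis using assms[of "Suc i"] assms[of i] by linarith
qed

lemma beyond_iff: "beyond scl e m x \<longleftrightarrow> (\<forall>i<m. coord x i = 0)"
  by (auto simp: beyond_def basis_supp_def not_le[symmetric] subset_iff)

lemma beyond_mono: "beyond scl e m x \<Longrightarrow> m' \<le> m \<Longrightarrow> beyond scl e m' x"
  by (simp add: beyond_iff)

lemma beyond_scl: "beyond scl e m x \<Longrightarrow> beyond scl e m (scl c x)"
  by (simp add: beyond_iff coord_scl)

lemma proj_beyond: "beyond scl e m x \<Longrightarrow> proj m x = 0"
  by (simp add: beyond_iff)

text \<open>The proof of the open mapping theorem, with the norm \<open>SUP m. norm (proj m x)\<close> in the role of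
  the finer complete norm.\<close>

lemma ex_dense_proj_bounded:
  obtains k r where "0 < r" "0 < k"
    "\<And>x. norm x < r \<Longrightarrow> x \<in> closure {u. \<forall>m. norm (proj m u) \<le> k}"
proof -
  define A where "A k = {u. \<forall>m. norm (proj m u) \<le> k}" for k :: real
  have cover: "\<exists>k::nat. x \<in> A (real k)" for x
  proof -
    have "Bseq (\<lambda>m. proj m x)"
      using proj_tendsto convergent_imp_Bseq convergent_def by blast
    then obtain K where "\<And>m. norm (proj m x) \<le> K"
      by (auto simp: Bseq_def)
    moreover obtain k :: nat where "K \<le> real k"
      using real_arch_simple by blast
    ultimately show ?thesis
      by (auto simp: A_def intro: order_trans)
  qed
  have "\<exists>k::nat. interior (closure (A k)) \<noteq> {}"
  proof (rule ccontr)
    assume "\<not> ?thesis"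
    then have nowhere: "closedin Met_TC.mtopology T \<and> Met_TC.mtopology interior_of T = {}"
      if "T \<in> range (\<lambda>k::nat. closure (A (real k)))" for T
      using that by auto
    have "Met_TC.mtopology interior_of \<Union> (range (\<lambda>k::nat. closure (A (real k)))) = {}"
    proof (rule Met_TC.metric_Baire_category_alt[OF _ _ nowhere])
      show "Met_TC.mcomplete TYPE('a)"
        by (simp add: complete_UNIV)
    qed simp_all
    moreover have "\<Union> (range (\<lambda>k::nat. closure (A k))) = UNIV"
    proof -
      have "x \<in> \<Union> (range (\<lambda>k::nat. closure (A (real k))))" for x
        using cover[of x] closure_subset[of "A (real _)"] by auto
      then show ?thesis by auto
    qed
    ultimately show False
      by simp
  qed
  then obtain k :: nat and x0 r where "0 < r" and r: "ball x0 r \<subseteq> closure (A k)"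
    by (meson all_not_in_conv mem_interior)
  \<comment> \<open>The ball found is centred at \<open>x0\<close>; half the difference of
    \<open>x0 + x\<close> and \<open>x0 - x\<close> recentres it at 0. The bound
    \<open>k + 1\<close> instead of \<open>k\<close> ensures positivity.\<close>
  have "x \<in> closure (A (real k + 1))" if "norm x < r" for x
  proof (unfold closure_approachable, intro allI impI)
    fix \<epsilon> :: real assume "0 < \<epsilon>"
    have "x0 + x \<in> closure (A k)" "x0 - x \<in> closure (A k)"
      using r that by (auto simp: subset_iff dist_norm)
    then obtain a b where ab: "a \<in> A k" "b \<in> A k" "dist a (x0 + x) < \<epsilon>" "dist b (x0 - x) < \<epsilon>"
      using \<open>0 < \<epsilon>\<close> by (meson closure_approachable)
    define y where "y = (1/2) *\<^sub>R (a - b)"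
    have "norm (proj m y) \<le> real k + 1" for m
    proof -
      have "norm (proj m y) = (1/2) * norm (proj m a - proj m b)"
        unfolding y_def proj_scaleR proj_diff by simp
      also have "\<dots> \<le> (1/2) * (norm (proj m a) + norm (proj m b))"
        using norm_triangle_ineq4 by (intro mult_left_mono) auto
      also have "\<dots> \<le> real k"
        using ab(1,2) add_mono[of "norm (proj m a)" k "norm (proj m b)" k] unfolding A_def by simp
      finally show ?thesis by simp
    qed
    then have "y \<in> A (real k + 1)"
      by (simp add: A_def)
    moreover have "dist y x < \<epsilon>"
    proof -
      have "y - x = (1/2) *\<^sub>R ((a - (x0 + x)) - (b - (x0 - x)))"
        by (simp add: y_def algebra_simps flip: scaleR_add_left)
      then have "norm (y - x) = (1/2) * norm ((a - (x0 + x)) - (b - (x0 - x)))"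
        by simp
      also have "\<dots> \<le> (1/2) * (norm (a - (x0 + x)) + norm (b - (x0 - x)))"
        by (intro mult_left_mono norm_triangle_ineq4) auto
      also have "\<dots> < \<epsilon>"
        using ab by (simp add: dist_norm)
      finally show ?thesis by (simp add: dist_norm)
    qed
    ultimately show "\<exists>y\<in>A (real k + 1). dist y x < \<epsilon>" by blast
  qed
  then show ?thesis
    using that[of r "real k + 1"] \<open>0 < r\<close> by (simp add: A_def)
qed

text \<open>Successive approximation writes \<open>x\<close> as a series of vectors
  \<open>u j\<close> whose projections are bounded by \<open>k / 2^j\<close> for all
  \<open>m\<close> at once. Since \<open>proj m\<close> is not yet known to be continuous,
  \<open>proj m x\<close> cannot be summed term by term before the coordinates of the sum are
  identified.\<close>

lemma proj_bounded_on_ball: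
  obtains r B where "0 < r" "\<And>x m. norm x < r \<Longrightarrow> norm (proj m x) \<le> B"
proof -
  obtain k r where rk: "0 < r" "0 < k"
    "\<And>x. norm x < r \<Longrightarrow> x \<in> closure {u. \<forall>m. norm (proj m u) \<le> k}"
    by (rule ex_dense_proj_bounded) blast
  have "\<exists>u. (\<forall>m. norm (proj m u) \<le> k / 2^j) \<and> norm (x - u) < r / 2^Suc j"
    if "norm x < r / 2^j" for x j
  proof -
    have "norm (2^j *\<^sub>R x) < r"
      using that by (simp add: field_simps)
    then obtain v where v: "\<And>m. norm (proj m v) \<le> k" "dist v (2^j *\<^sub>R x) < r/2"
      using rk by (smt (verit) closure_approachable half_gt_zero mem_Collect_eq)
    let ?u = "(1/2^j) *\<^sub>R v"
    have "x - ?u = (1/2^j) *\<^sub>R (2^j *\<^sub>R x - v)"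
      by (simp add: algebra_simps)
    then have "norm (x - ?u) = dist v (2^j *\<^sub>R x) / 2^j"
      by (simp add: dist_norm norm_minus_commute)
    also have "\<dots> < (r/2) / 2^j"
      using v(2) by (intro divide_strict_right_mono) auto
    finally have "norm (x - ?u) < r / 2^Suc j" by simp
    moreover have "norm (proj m ?u) \<le> k / 2^j" for m
      unfolding proj_scaleR using v(1)[of m] by (simp add: divide_right_mono)
    ultimately show ?thesis by blast
  qed
  then have "\<forall>j x. \<exists>u. norm x < r / 2^j \<longrightarrow>
      (\<forall>m. norm (proj m u) \<le> k / 2^j) \<and> norm (x - u) < r / 2^Suc j"
    by blast
  then obtain U where "\<forall>j x. norm x < r / 2^j \<longrightarrow>
      (\<forall>m. norm (proj m (U j x)) \<le> k / 2^j) \<and> norm (x - U j x) < r / 2^Suc j"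
    unfolding choice_iff by blast
  then have U: "\<And>x j m. norm x < r / 2^j \<Longrightarrow> norm (proj m (U j x)) \<le> k / 2^j"
    "\<And>x j. norm x < r / 2^j \<Longrightarrow> norm (x - U j x) < r / 2^Suc j"
    by blast+
  have "norm (proj m x) \<le> 2 * k" if x: "norm x < r" for x m
  proof -
    define R where "R = rec_nat x (\<lambda>j y. y - U j y)"
    have R0: "R 0 = x" and RS: "R (Suc j) = R j - U j (R j)" for j
      by (simp_all add: R_def)
    have Rn: "norm (R j) < r / 2^j" for j
      by (induction j) (use x U(2) in \<open>auto simp: R0 RS\<close>)
    define u where "u j = U j (R j)" for j
    have u: "norm (proj m (u j)) \<le> k / 2^j" for j m
      unfolding u_def by (rule U(1)[OF Rn])
    have geo: "(\<lambda>j. k / 2^j) sums (2 * k)"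
      using sums_mult[OF geometric_sums[of "1/2::real"], of k] by (simp add: power_one_over field_simps)
    have "(\<lambda>j. R j) \<longlonglongrightarrow> 0"
    proof (rule Lim_null_comparison)
      show "\<forall>\<^sub>F j in sequentially. norm (R j) \<le> r / 2^j"
        using Rn by (intro always_eventually allI less_imp_le)
      show "(\<lambda>j. r / 2^j) \<longlonglongrightarrow> 0"
        by (intro tendsto_divide_0[OF tendsto_const] filterlim_realpow_sequentially_gt1
            filterlim_at_top_imp_at_infinity) auto
    qed
    then have "(\<lambda>J. x - R J) \<longlonglongrightarrow> x"
      using tendsto_diff[OF tendsto_const] by fastforce
    moreover have "(\<Sum>j<J. u j) = x - R J" for J
      by (induction J) (auto simp: R0 RS u_def)
    ultimately have u_sums: "u sums x"
      by (simp add: sums_def)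
    have coord_summable: "summable (\<lambda>j. coord (u j) i)" for i
    proof (rule summable_comparison_test)
      show "\<exists>N. \<forall>j\<ge>N. norm (coord (u j) i) \<le> 2 * (k / 2^j)"
        using norm_coord_le[OF u] by blast
      show "summable (\<lambda>j. 2 * (k / 2^j))"
        using geo by (intro summable_mult) (auto simp: summable_def)
    qed
    \<comment> \<open>Candidate coordinates of \<open>x\<close>. The series of projections converges
      uniformly in \<open>m\<close>, so the limits over \<open>J\<close> and \<open>m\<close> may be
      exchanged; hence \<open>c\<close> expands \<open>x\<close>, and uniqueness gives
      \<open>coord x = c\<close>.\<close>
    define c where "c i = (\<Sum>j. coord (u j) i)" for i
    have proj_sums: "(\<lambda>j. proj m (u j)) sums (\<Sum>i<m. scl (c i) (e i))" for m
      unfolding c_def using coord_summable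
      by (intro sums_sum bounded_linear.sums[OF bounded_linear_scl_left]) (auto simp: summable_sums)
    have unif: "uniform_limit UNIV (\<lambda>J m. \<Sum>j<J. proj m (u j)) (\<lambda>m. \<Sum>j. proj m (u j)) sequentially"
      by (rule Weierstrass_m_test[OF u]) (use geo in \<open>auto simp: summable_def\<close>)
    have "\<forall>\<^sub>F J in sequentially.
        ((\<lambda>m. \<Sum>j<J. proj m (u j)) \<longlongrightarrow> (\<Sum>j<J. u j)) sequentially"
      by (intro always_eventually allI tendsto_sum proj_tendsto)
    then have "(\<lambda>m. \<Sum>j. proj m (u j)) \<longlonglongrightarrow> x"
      by (rule swap_uniform_limit'[OF _ u_sums[unfolded sums_def] unif]) simp_all
    then have "(\<lambda>i. scl (c i) (e i)) sums x"
      using proj_sums unfolding sums_def[of _ x] by (simp add: sums_iff)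
    then have "coord x = c" by (rule coord_eqI)
    then have "proj m x = (\<Sum>j. proj m (u j))"
      using proj_sums[of m] by (simp add: sums_iff)
    also have "norm \<dots> \<le> 2 * k"
    proof -
      have "norm (\<Sum>j. proj m (u j)) \<le> (\<Sum>j. k / 2^j)"
        using u geo by (intro norm_suminf_le) (auto simp: summable_def)
      then show ?thesis using geo by (simp add: sums_iff)
    qed
    finally show ?thesis .
  qed
  with \<open>0 < r\<close> that show ?thesis by blast
qed

lemma basis_constant:
  obtains K where "1 \<le> K" "\<And>m x. norm (proj m x) \<le> K * norm x"
proof -
  obtain r B where r: "0 < r" "\<And>x m. norm x < r \<Longrightarrow> norm (proj m x) \<le> B"
    by (rule proj_bounded_on_ball) blast
  let ?K = "max 1 (2 * B / r)"
  have "norm (proj m x) \<le> ?K * norm x" for m x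
  proof (cases "x = 0")
    case True
    then show ?thesis by (simp add: coord_0)
  next
    case False
    define q where "q = r / (2 * norm x)"
    have q: "0 < q" using False r by (simp add: q_def)
    have "norm (q *\<^sub>R x) < r"
      using False r by (simp add: q_def)
    then have "norm (proj m (q *\<^sub>R x)) \<le> B" by (rule r)
    then have "q * norm (proj m x) \<le> B"
      unfolding proj_scaleR using q by simp
    then have "norm (proj m x) \<le> 2 * B / r * norm x"
      using False r by (simp add: q_def field_simps)
    also have "\<dots> \<le> ?K * norm x"
      by (intro mult_right_mono) auto
    finally show ?thesis .
  qed
  then show ?thesis by (intro that[of ?K]) auto
qed

end

subsection \<open>Asymptotic games\<close>

lemma asym_game_mono:
  "asym_game scl e n P xs \<Longrightarrow> (\<And>ys. P ys \<Longrightarrow> Q ys) \<Longrightarrow> asym_game scl e n Q xs"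
  by (induction n arbitrary: xs) (simp, simp, blast)

lemma asym_game_ex: "asym_game scl e n P xs \<Longrightarrow> \<exists>ys. P ys"
  by (induction n arbitrary: xs) auto

text \<open>If neither condition alone could be forced, there would be a refuting cutoff for each of
  them; the larger of the two refutes the disjunction.\<close>

lemma asym_game_disj:
  "asym_game scl e n (\<lambda>ys. P ys \<or> Q ys) xs \<Longrightarrow> asym_game scl e n P xs \<or> asym_game scl e n Q xs"
proof (induction n arbitrary: xs)
  case (Suc n)
  show ?case
  proof (rule ccontr)
    assume "\<not> ?thesis"
    then obtain m m' where
      "\<And>x. beyond scl e m x \<Longrightarrow> \<not> asym_game scl e n P (xs @ [x])"
      "\<And>x. beyond scl e m' x \<Longrightarrow> \<not> asym_game scl e n Q (xs @ [x])"
      by auto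
    moreover obtain x where "beyond scl e (max m m') x"
      "asym_game scl e n (\<lambda>ys. P ys \<or> Q ys) (xs @ [x])"
      using Suc.prems by (metis asym_game.simps(2))
    moreover from this have "beyond scl e m x" "beyond scl e m' x"
      by (auto simp: beyond_def)
    ultimately show False
      using Suc.IH by blast
  qed
qed simp

lemma asym_game_finite_disj:
  assumes "finite F" "asym_game scl e n (\<lambda>ys. \<exists>i\<in>F. P i ys) xs"
  shows "\<exists>i\<in>F. asym_game scl e n (P i) xs"
  using assms
proof (induction F)
  case empty
  then show ?case using asym_game_ex by fastforce
next
  case (insert j F)
  then show ?case
    using asym_game_disj[of scl e n "P j" "\<lambda>ys. \<exists>i\<in>F. P i ys" xs] by auto
qed

lemma asym_game_strategy:
  assumes "R xs" "\<And>ys m. R ys \<Longrightarrow> \<exists>x. beyond scl e m x \<and> R (ys @ [x])"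
  shows "asym_game scl e n (\<lambda>ys. R ys \<and> length ys = length xs + n) xs"
  using assms(1)
proof (induction n arbitrary: xs)
  case (Suc n)
  have "\<exists>x. beyond scl e m x \<and> asym_game scl e n (\<lambda>ys. R ys \<and> length ys = length xs + Suc n) (xs @ [x])"
    for m
  proof -
    obtain x where x: "beyond scl e m x" "R (xs @ [x])"
      using assms(2)[OF Suc.prems] by blast
    from Suc.IH[OF x(2)] x(1) show ?thesis by (intro exI[of _ x]) simp
  qed
  then show ?case by simp
qed simp

text \<open>By \<open>asym_game_finite_disj\<close> the winning conditions that the vector player cannot enforce form an
  ideal, so every invariant of the outcome with values in a compact space clusters.\<close>

lemma asym_game_cluster_point:
  fixes \<phi> :: "'a::banach list \<Rightarrow> 'c::topological_space"
  assumes "asym_game scl e n P xs" "compact S" "\<And>ys. P ys \<Longrightarrow> \<phi> ys \<in> S"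
  shows "\<exists>\<nu>\<in>S. \<forall>U. open U \<and> \<nu> \<in> U \<longrightarrow> asym_game scl e n (\<lambda>ys. P ys \<and> \<phi> ys \<in> U) xs"
proof (rule ccontr)
  assume "\<not> ?thesis"
  then have "\<forall>\<nu>\<in>S. \<exists>U. open U \<and> \<nu> \<in> U \<and> \<not> asym_game scl e n (\<lambda>ys. P ys \<and> \<phi> ys \<in> U) xs"
    by blast
  then obtain U where U: "\<And>\<nu>. \<nu> \<in> S \<Longrightarrow> open (U \<nu>)" "\<And>\<nu>. \<nu> \<in> S \<Longrightarrow> \<nu> \<in> U \<nu>"
    "\<And>\<nu>. \<nu> \<in> S \<Longrightarrow> \<not> asym_game scl e n (\<lambda>ys. P ys \<and> \<phi> ys \<in> U \<nu>) xs"
    by (auto dest!: bchoice)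
  obtain D where D: "D \<subseteq> S" "finite D" "S \<subseteq> (\<Union>\<nu>\<in>D. U \<nu>)"
    using compactE_image[OF \<open>compact S\<close>, of S U] U by blast
  have "asym_game scl e n (\<lambda>ys. \<exists>\<nu>\<in>D. P ys \<and> \<phi> ys \<in> U \<nu>) xs"
    by (rule asym_game_mono[OF assms(1)]) (use assms(3) D in blast)
  then have "\<exists>\<nu>\<in>D. asym_game scl e n (\<lambda>ys. P ys \<and> \<phi> ys \<in> U \<nu>) xs"
    by (rule asym_game_finite_disj[OF D(2)])
  with U(3) D(1) show False by blast
qed

section \<open>Compactness and equicontinuity of norms on coefficient sequences\<close>

lemma compact_Collect_fun_Icc:
  fixes B :: "'b \<Rightarrow> real"
  shows "compact {\<mu>. \<forall>a. 0 \<le> \<mu> a \<and> \<mu> a \<le> B a}"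
proof -
  have "compactin (product_topology (\<lambda>_. euclidean) UNIV) (PiE UNIV (\<lambda>a. {0..B a}))"
    by (simp add: compactin_PiE)
  moreover have "PiE UNIV (\<lambda>a. {0..B a}) = {\<mu>. \<forall>a. 0 \<le> \<mu> a \<and> \<mu> a \<le> B a}"
    by (auto simp: PiE_UNIV_domain)
  ultimately show ?thesis
    by (simp add: euclidean_product_topology)
qed

definition coef_seminorm :: "nat \<Rightarrow> ((nat \<Rightarrow> 'k::real_normed_field) \<Rightarrow> real) \<Rightarrow> bool" where
  "coef_seminorm n \<mu> \<longleftrightarrow>
     (\<forall>a b. \<mu> (\<lambda>i. a i + b i) \<le> \<mu> a + \<mu> b) \<and>
     (\<forall>c a. \<mu> (\<lambda>i. c * a i) = norm c * \<mu> a) \<and>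
     (\<forall>a. 0 \<le> \<mu> a \<and> \<mu> a \<le> (\<Sum>i<n. norm (a i)))"

lemma coef_seminorm_diff_le:
  assumes "coef_seminorm n \<mu>"
  shows "\<bar>\<mu> a - \<mu> b\<bar> \<le> (\<Sum>i<n. norm (a i - b i))"
proof -
  have "\<mu> a - \<mu> b \<le> (\<Sum>i<n. norm (a i - b i))" for a b
  proof -
    have "\<mu> (\<lambda>i. (a i - b i) + b i) \<le> \<mu> (\<lambda>i. a i - b i) + \<mu> b"
      using assms unfolding coef_seminorm_def by (elim conjE allE)
    moreover have "\<mu> (\<lambda>i. a i - b i) \<le> (\<Sum>i<n. norm (a i - b i))"
      using assms unfolding coef_seminorm_def by auto
    ultimately show ?thesis by simp
  qed
  from this[of a b] this[of b a] show ?thesis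
    by (simp add: norm_minus_commute abs_le_iff)
qed

text \<open>By homogeneity the largest of the first \<open>n\<close> coordinates may be taken to
  have modulus 1. Such sequences lie close to a finite net, and \<open>D * \<nu>\<close> is at least
  1 on them, which turns the absolute error into a relative one.\<close>

lemma finite_net_coef_seminorm:
  fixes D \<eta> :: real
  assumes "0 < D" "0 < \<eta>"
  obtains A :: "(nat \<Rightarrow> 'k::{real_normed_field, euclidean_space}) set" and \<delta> :: real
  where "finite A" "0 < \<delta>"
    "\<And>\<mu> \<nu> a. coef_seminorm n \<mu> \<Longrightarrow> coef_seminorm n \<nu> \<Longrightarrow>
      (\<And>a i. i < n \<Longrightarrow> norm (a i) \<le> D * \<nu> a) \<Longrightarrow> (\<And>a. a \<in> A \<Longrightarrow> \<bar>\<mu> a - \<nu> a\<bar> < \<delta>) \<Longrightarrow>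
      \<bar>\<mu> a - \<nu> a\<bar> \<le> \<eta> * \<nu> a"
proof -
  \<comment> \<open>Passing to a net point costs at most \<open>n * \<delta>\<close> in each of the
    two seminorms, and comparing them there costs one more \<open>\<delta>\<close>.\<close>
  define \<delta> where "\<delta> = \<eta> / ((2 * real n + 1) * D)"
  have \<delta>: "0 < \<delta>" using assms by (simp add: \<delta>_def)
  obtain F where F: "finite F" "cball 0 1 \<subseteq> (\<Union>f\<in>F. ball (f::'k) \<delta>)"
  proof (rule compactE_image[of "cball (0::'k) 1" UNIV "\<lambda>f. ball f \<delta>"])
    show "cball (0::'k) 1 \<subseteq> (\<Union>c. ball c \<delta>)"
      using \<delta> by (auto intro: centre_in_ball[THEN iffD2])
  qed auto
  define A where "A = {a. \<forall>i. (i \<in> {..<n} \<longrightarrow> a i \<in> F) \<and> (i \<notin> {..<n} \<longrightarrow> a i = (0::'k))}"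
  have "finite A"
    unfolding A_def by (intro finite_set_of_finite_funs) (use F in auto)
  moreover have "\<bar>\<mu> a - \<nu> a\<bar> \<le> \<eta> * \<nu> a"
    if \<mu>: "coef_seminorm n \<mu>" and \<nu>: "coef_seminorm n \<nu>"
      and D: "\<And>a i. i < n \<Longrightarrow> norm (a i) \<le> D * \<nu> a"
      and near: "\<And>a. a \<in> A \<Longrightarrow> \<bar>\<mu> a - \<nu> a\<bar> < \<delta>" for \<mu> \<nu> a
  proof (cases "\<forall>i<n. a i = 0")
    case True
    then have "(\<Sum>i<n. norm (a i)) = 0" by simp
    then have "\<mu> a = 0" "\<nu> a = 0"
      using \<mu> \<nu> unfolding coef_seminorm_def by (metis order_antisym)+
    then show ?thesis by simp
  next
    case False
    define r where "r = Max ((\<lambda>i. norm (a i)) ` {..<n})"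
    have le_r: "norm (a i) \<le> r" if "i < n" for i
      unfolding r_def using that by (intro Max_ge) auto
    have "r \<in> (\<lambda>i. norm (a i)) ` {..<n}"
      unfolding r_def using False by (intro Max_in) auto
    then obtain q where q: "q < n" "norm (a q) = r" by auto
    have r: "0 < r" using False le_r by (metis less_le_trans zero_less_norm_iff)
    define b where "b i = of_real (1 / r) * a i" for i
    have b_le: "norm (b i) \<le> 1" if "i < n" for i
      using le_r[OF that] r by (simp add: b_def norm_mult norm_divide)
    have a_eq: "a = (\<lambda>i. of_real r * b i)"
      using r by (auto simp: b_def)
    have "\<forall>i. \<exists>f. i < n \<longrightarrow> f \<in> F \<and> norm (b i - f) < \<delta>"
      using F(2) b_le by (fastforce simp: subset_iff dist_norm norm_minus_commute)
    then obtain f where f: "\<And>i. i < n \<Longrightarrow> f i \<in> F" "\<And>i. i < n \<Longrightarrow> norm (b i - f i) < \<delta>"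
      unfolding choice_iff by blast
    define b' where "b' i = (if i < n then f i else 0)" for i
    have "b' \<in> A" using f by (auto simp: A_def b'_def)
    have "(\<Sum>i<n. norm (b i - b' i)) \<le> (\<Sum>i<n. \<delta>)"
      using f by (intro sum_mono) (auto simp: b'_def less_imp_le)
    then have "\<bar>\<mu> b - \<mu> b'\<bar> \<le> real n * \<delta>" "\<bar>\<nu> b - \<nu> b'\<bar> \<le> real n * \<delta>"
      using coef_seminorm_diff_le[OF \<mu>, of b b'] coef_seminorm_diff_le[OF \<nu>, of b b'] by simp_all
    then have "\<bar>\<mu> b - \<nu> b\<bar> \<le> (2 * real n + 1) * \<delta> * 1"
      using near[OF \<open>b' \<in> A\<close>] by (simp add: algebra_simps)
    also have "1 \<le> D * \<nu> b"
      using D[OF q(1), of b] q r by (simp add: b_def norm_mult norm_divide)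
    then have "(2 * real n + 1) * \<delta> * 1 \<le> (2 * real n + 1) * \<delta> * (D * \<nu> b)"
      using \<delta> by (intro mult_left_mono) auto
    also have "\<dots> = \<eta> * \<nu> b"
    proof -
      have "2 * real n + 1 \<noteq> 0" by linarith
      then show ?thesis using assms by (simp add: \<delta>_def)
    qed
    finally have "r * \<bar>\<mu> b - \<nu> b\<bar> \<le> r * (\<eta> * \<nu> b)"
      using r by simp
    moreover have "\<mu> a = r * \<mu> b" "\<nu> a = r * \<nu> b"
      using \<mu> \<nu> r unfolding a_eq coef_seminorm_def by simp_all
    ultimately show ?thesis
      using r by (simp add: abs_mult right_diff_distrib[symmetric] mult_ac)
  qed
  ultimately show ?thesis using that \<delta> by blast
qed

context banach_over
begin

definition lincomb :: "'a list \<Rightarrow> (nat \<Rightarrow> 'k) \<Rightarrow> 'a" where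
  "lincomb xs a = (\<Sum>i<length xs. scl (a i) (xs ! i))"

lemma lincomb_add: "lincomb xs (\<lambda>i. a i + b i) = lincomb xs a + lincomb xs b"
  by (simp add: lincomb_def scale_left_distrib sum.distrib)

lemma lincomb_scl: "lincomb xs (\<lambda>i. c * a i) = scl c (lincomb xs a)"
  by (simp add: lincomb_def scale_sum_right)

lemma lincomb_snoc: "lincomb (xs @ [x]) a = lincomb xs a + scl (a (length xs)) x"
  by (simp add: lincomb_def nth_append)

lemma coef_seminorm_lincomb:
  assumes "\<And>x. x \<in> set xs \<Longrightarrow> norm x = 1"
  shows "coef_seminorm (length xs) (\<lambda>a. norm (lincomb xs a))"
  unfolding coef_seminorm_def
proof (intro conjI allI)
  show "norm (lincomb xs (\<lambda>i. a i + b i)) \<le> norm (lincomb xs a) + norm (lincomb xs b)" for a b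
    unfolding lincomb_add by (rule norm_triangle_ineq)
  show "norm (lincomb xs a) \<le> (\<Sum>i<length xs. norm (a i))" for a
    unfolding lincomb_def using assms
    by (intro order_trans[OF norm_sum] sum_mono) (simp add: norm_scl)
qed (simp_all add: lincomb_scl norm_scl)

text \<open>A bound for the coordinate functionals on the span of \<open>xs\<close>. It passes to
  pointwise cluster points of the norms and makes them definite.\<close>

definition coef_bound :: "real \<Rightarrow> 'a list \<Rightarrow> bool" where
  "coef_bound D xs \<longleftrightarrow> (\<forall>a. \<forall>i<length xs. norm (a i) \<le> D * norm (lincomb xs a))"

end

context schauder_space
begin

text \<open>Far enough out, \<open>proj M\<close> kills the new vector and hardly moves the old
  ones. Applied to a combination \<open>w\<close> with old part \<open>s\<close>, it gives
  \<open>norm s \<le> 2 * K * norm w\<close>; the modulus of the new coefficient is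
  \<open>norm (w - s)\<close>.\<close>

lemma coef_bound_snoc:
  assumes K: "1 \<le> K" "\<And>m x. norm (proj m x) \<le> K * norm x"
    and D: "1 \<le> D" "coef_bound D xs"
  obtains M where "\<And>x. norm x = 1 \<Longrightarrow> beyond scl e M x \<Longrightarrow> coef_bound ((1 + 2 * K) * D) (xs @ [x])"
proof -
  let ?k = "length xs"
  \<comment> \<open>Each old coefficient is at most \<open>D * norm s\<close>, so the errors of all
    old vectors add up to at most half of \<open>norm s\<close>.\<close>
  define \<delta> where "\<delta> = 1 / (2 * (real ?k + 1) * D)"
  have \<delta>: "0 < \<delta>" using D by (simp add: \<delta>_def)
  have "\<forall>\<^sub>F m in sequentially. \<forall>i\<in>{..<?k}. norm (xs ! i - proj m (xs ! i)) < \<delta>"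
  proof (intro eventually_ball_finite ballI)
    fix i
    show "\<forall>\<^sub>F m in sequentially. norm (xs ! i - proj m (xs ! i)) < \<delta>"
      using tendstoD[OF proj_tendsto[of "xs ! i"] \<delta>] by (simp add: dist_norm norm_minus_commute)
  qed simp
  then obtain M where M: "\<And>i. i < ?k \<Longrightarrow> norm (xs ! i - proj M (xs ! i)) < \<delta>"
    by (auto simp: eventually_sequentially)
  have "coef_bound ((1 + 2 * K) * D) (xs @ [x])" if x: "norm x = 1" "beyond scl e M x" for x
    unfolding coef_bound_def
  proof (intro allI impI)
    fix a i assume "i < length (xs @ [x])"
    define s where "s = lincomb xs a"
    define w where "w = lincomb (xs @ [x]) a"
    have w_eq: "w = s + scl (a ?k) x"
      by (simp add: w_def s_def lincomb_snoc)
    have a_le: "norm (a j) \<le> D * norm s" if "j < ?k" for j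
      using D that by (simp add: coef_bound_def s_def)
    have proj_s: "proj M s = (\<Sum>j<?k. scl (a j) (proj M (xs ! j)))" 
    proof -
      have "proj M (\<Sum>j\<in>J. scl (a j) (xs ! j)) = (\<Sum>j\<in>J. scl (a j) (proj M (xs ! j)))" if "finite J" for J
        using that
      proof (induction J)
        case (insert j J)
        show ?case
          by (simp only: sum.insert[OF insert.hyps] proj_add proj_scl insert.IH)
      qed (simp add: coord_0)
      then show ?thesis by (simp add: s_def lincomb_def)
    qed
    have "norm (s - proj M s) \<le> (\<Sum>j<?k. norm (scl (a j) (xs ! j - proj M (xs ! j))))"
      unfolding proj_s by (simp add: s_def lincomb_def sum_subtractf[symmetric] scale_right_diff_distrib[symmetric] norm_sum)
    also have "\<dots> \<le> (\<Sum>j<?k. (D * norm s) * \<delta>)"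
      unfolding norm_scl using M a_le D by (intro sum_mono mult_mono) (auto intro: less_imp_le)
    also have "\<dots> = (real ?k / (real ?k + 1)) * (norm s / 2)"
    proof -
      have "real ?k + 1 \<noteq> 0" by linarith
      then show ?thesis using D by (simp add: \<delta>_def)
    qed
    also have "\<dots> \<le> 1 * (norm s / 2)"
      by (intro mult_right_mono) auto
    finally have "norm s / 2 \<le> norm (proj M s)"
      using norm_triangle_ineq2[of s "proj M s"] by simp
    also have "proj M s = proj M w"
      using proj_beyond[OF beyond_scl[OF x(2)], of "a ?k"] by (simp only: w_eq proj_add add_0_right)
    also have "norm (proj M w) \<le> K * norm w" by (rule K)
    finally have s_le: "norm s \<le> 2 * K * norm w" by simp
    show "norm (a i) \<le> (1 + 2 * K) * D * norm w"
    proof (cases "i < ?k")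
      case True
      have "norm (a i) \<le> D * norm s" using a_le True by simp
      also have "\<dots> \<le> D * (2 * K * norm w)" using s_le D by simp
      also have "\<dots> \<le> (1 + 2 * K) * D * norm w" using D by (simp add: algebra_simps)
      finally show ?thesis .
    next
      case False
      then have "i = ?k" using \<open>i < length (xs @ [x])\<close> by simp
      then have "norm (a i) = norm (w - s)" by (simp add: w_eq norm_scl x)
      also have "\<dots> \<le> norm w + norm s" by (rule norm_triangle_ineq4)
      also have "\<dots> \<le> (1 + 2 * K) * norm w * 1" using s_le by (simp add: algebra_simps)
      also have "\<dots> \<le> (1 + 2 * K) * norm w * D" using D K by (intro mult_left_mono) auto
      finally show ?thesis by (simp add: mult_ac)
    qed
  qed
  then show ?thesis by (rule that)
qed

end

section \<open>The span of the first unit sequences as a normed space\<close>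

definition unit_coef :: "nat \<Rightarrow> nat \<Rightarrow> 'k::zero_neq_one" where
  "unit_coef i = (\<lambda>j. if j = i then 1 else 0)"

lemma sum_unit_coef:
  fixes a :: "nat \<Rightarrow> 'k::comm_ring_1"
  shows "(\<Sum>i<n. (\<lambda>j. a i * unit_coef i j)) = (\<lambda>j. if j < n then a j else 0)"
proof (induction n)
  case (Suc n)
  then show ?case
    by (auto simp: plus_fun_def unit_coef_def fun_eq_iff less_Suc_eq)
qed (simp add: zero_fun_def)

lemma vector_space_pointwise: "vector_space (\<lambda>(c::'k::field) f j. c * f j)"
  by standard (simp_all add: plus_fun_def algebra_simps)

lemma span_unit_coef_subset:
  "module.span (\<lambda>c f j. c * f j) (unit_coef ` {..<n} :: (nat \<Rightarrow> 'k::field) set) \<subseteq> {f. \<forall>j\<ge>n. f j = 0}"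
proof -
  interpret vector_space "\<lambda>(c::'k) f j. c * f j"
    by (rule vector_space_pointwise)
  have "subspace {f :: nat \<Rightarrow> 'k. \<forall>j\<ge>n. f j = 0}"
    by (auto simp: subspace_def)
  then show ?thesis
    by (intro span_minimal) (auto simp: unit_coef_def)
qed

lemma inj_unit_coef: "inj_on (unit_coef :: nat \<Rightarrow> nat \<Rightarrow> 'k::zero_neq_one) A"
  by (auto simp: inj_on_def unit_coef_def fun_eq_iff split: if_splits)

lemma independent_unit_coef:
  "\<not> module.dependent (\<lambda>c f j. c * f j) (unit_coef ` {..<n} :: (nat \<Rightarrow> 'k::field) set)"
proof -
  interpret vector_space "\<lambda>(c::'k) f j. c * f j"
    by (rule vector_space_pointwise)
  have "u v = 0" if 0: "(\<Sum>v\<in>unit_coef ` {..<n}. (\<lambda>j. u v * v j)) = 0" and v: "v \<in> unit_coef ` {..<n}"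
    for u and v :: "nat \<Rightarrow> 'k"
  proof -
    have "(\<Sum>i<n. (\<lambda>j. u (unit_coef i) * unit_coef i j)) = 0"
      using 0 by (simp add: sum.reindex[OF inj_unit_coef])
    then have "(\<lambda>j. if j < n then u (unit_coef j) else 0) = 0"
      unfolding sum_unit_coef[of "\<lambda>i. u (unit_coef i)"] .
    then show ?thesis
      using v by (auto simp: fun_eq_iff split: if_splits)
  qed
  then show ?thesis
    by (auto simp: dependent_finite)
qed

text \<open>\<open>\<nu>\<close> does not see the coordinates from \<open>n\<close> on; definiteness
  uses that members of the span vanish there.\<close>

lemma is_norm_on_unit_coef_span:
  assumes "coef_seminorm n \<nu>" "\<And>a i. i < n \<Longrightarrow> norm (a i) \<le> D * \<nu> a"
  shows "is_norm_on (\<lambda>c f j. c * f j)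
    (module.span (\<lambda>c f j. c * f j) (unit_coef ` {..<n})) (\<nu> :: (nat \<Rightarrow> 'k::real_normed_field) \<Rightarrow> real)"
  unfolding is_norm_on_def
proof (intro conjI ballI allI)
  fix x :: "nat \<Rightarrow> 'k" assume "x \<in> module.span (\<lambda>c f j. c * f j) (unit_coef ` {..<n})"
  then have x: "\<forall>j\<ge>n. x j = 0"
    using span_unit_coef_subset by blast
  show "(\<nu> x = 0) = (x = 0)"
  proof
    assume "\<nu> x = 0"
    then have "x i = 0" if "i < n" for i
      using assms(2)[OF that, of x] by simp
    with x show "x = 0"
      by (auto simp: fun_eq_iff not_less[symmetric])
  next
    assume "x = 0"
    moreover have "\<nu> x \<le> (\<Sum>i<n. norm (x i))" "0 \<le> \<nu> x"
      using assms(1) by (auto simp: coef_seminorm_def)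
    ultimately show "\<nu> x = 0" by simp
  qed
qed (use assms(1) in \<open>simp_all add: coef_seminorm_def plus_fun_def\<close>)

lemma open_fun_near:
  fixes \<nu> :: "'b \<Rightarrow> real"
  assumes "finite A"
  shows "open {\<mu>. \<forall>a\<in>A. \<bar>\<mu> a - \<nu> a\<bar> < \<delta>}"
proof -
  have "open (\<Inter>a\<in>A. {\<mu>. \<bar>\<mu> a - \<nu> a\<bar> < \<delta>})"
    using assms by (intro open_INT ballI open_Collect_less continuous_intros)
      (auto intro: continuous_on_product_coordinates)
  moreover have "(\<Inter>a\<in>A. {\<mu>. \<bar>\<mu> a - \<nu> a\<bar> < \<delta>}) = {\<mu>. \<forall>a\<in>A. \<bar>\<mu> a - \<nu> a\<bar> < \<delta>}"
    by auto
  ultimately show ?thesis by simp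
qed

text \<open>The defining inequalities of a seminorm are closed conditions, each involving finitely many
  values only.\<close>

lemma coef_seminorm_pointwise_limit:
  fixes \<nu> :: "(nat \<Rightarrow> 'k::real_normed_field) \<Rightarrow> real"
  assumes "\<And>A \<delta>. finite A \<Longrightarrow> 0 < \<delta> \<Longrightarrow> \<exists>\<mu>. coef_seminorm n \<mu> \<and> (\<forall>a\<in>A. \<bar>\<mu> a - \<nu> a\<bar> < \<delta>)"
  shows "coef_seminorm n \<nu>"
  unfolding coef_seminorm_def
proof (intro conjI allI)
  fix a b :: "nat \<Rightarrow> 'k"
  show "\<nu> (\<lambda>i. a i + b i) \<le> \<nu> a + \<nu> b"
  proof (rule field_le_epsilon)
    fix \<epsilon> :: real assume "0 < \<epsilon>"
    then obtain \<mu> where "coef_seminorm n \<mu>" "\<bar>\<mu> a - \<nu> a\<bar> < \<epsilon> / 3" "\<bar>\<mu> b - \<nu> b\<bar> < \<epsilon> / 3"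
      "\<bar>\<mu> (\<lambda>i. a i + b i) - \<nu> (\<lambda>i. a i + b i)\<bar> < \<epsilon> / 3"
      using assms[of "{a, b, \<lambda>i. a i + b i}" "\<epsilon> / 3"] by auto
    moreover from this have "\<mu> (\<lambda>i. a i + b i) \<le> \<mu> a + \<mu> b"
      by (simp add: coef_seminorm_def)
    ultimately show "\<nu> (\<lambda>i. a i + b i) \<le> \<nu> a + \<nu> b + \<epsilon>"
      by linarith
  qed
next
  fix c and a :: "nat \<Rightarrow> 'k"
  have "\<bar>\<nu> (\<lambda>i. c * a i) - norm c * \<nu> a\<bar> \<le> 0"
  proof (rule field_le_epsilon)
    fix \<epsilon> :: real assume "0 < \<epsilon>"
    define \<delta> where "\<delta> = \<epsilon> / (1 + norm c)"
    have "0 < 1 + norm c" by (smt (verit) norm_ge_zero)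
    then have "0 < \<delta>" "\<epsilon> = (1 + norm c) * \<delta>"
      using \<open>0 < \<epsilon>\<close> by (simp_all add: \<delta>_def)
    then have \<delta>: "0 < \<delta>" "\<epsilon> = \<delta> + norm c * \<delta>"
      by (simp_all add: distrib_right)
    obtain \<mu> where \<mu>: "coef_seminorm n \<mu>" "\<bar>\<mu> a - \<nu> a\<bar> < \<delta>"
      "\<bar>\<mu> (\<lambda>i. c * a i) - \<nu> (\<lambda>i. c * a i)\<bar> < \<delta>"
      using assms[of "{a, \<lambda>i. c * a i}" \<delta>] \<delta> by auto
    have "\<mu> (\<lambda>i. c * a i) = norm c * \<mu> a"
      using \<mu>(1) by (simp add: coef_seminorm_def)
    moreover have "\<bar>norm c * \<mu> a - norm c * \<nu> a\<bar> \<le> norm c * \<delta>"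
      using \<mu>(2) by (simp add: abs_mult right_diff_distrib[symmetric] mult_left_mono)
    ultimately show "\<bar>\<nu> (\<lambda>i. c * a i) - norm c * \<nu> a\<bar> \<le> 0 + \<epsilon>"
      using \<mu>(3) \<delta>(2) by linarith
  qed
  then show "\<nu> (\<lambda>i. c * a i) = norm c * \<nu> a" by simp
next
  fix a :: "nat \<Rightarrow> 'k"
  have near: "\<exists>\<mu>. coef_seminorm n \<mu> \<and> \<bar>\<mu> a - \<nu> a\<bar> < \<epsilon>" if "0 < \<epsilon>" for \<epsilon>
    using assms[of "{a}" \<epsilon>] that by simp
  show "0 \<le> \<nu> a"
  proof (rule field_le_epsilon)
    fix \<epsilon> :: real assume "0 < \<epsilon>"
    then obtain \<mu> where "coef_seminorm n \<mu>" "\<bar>\<mu> a - \<nu> a\<bar> < \<epsilon>" using near by blast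
    moreover from this have "0 \<le> \<mu> a" by (simp add: coef_seminorm_def)
    ultimately show "0 \<le> \<nu> a + \<epsilon>" by linarith
  qed
  show "\<nu> a \<le> (\<Sum>i<n. norm (a i))"
  proof (rule field_le_epsilon)
    fix \<epsilon> :: real assume "0 < \<epsilon>"
    then obtain \<mu> where "coef_seminorm n \<mu>" "\<bar>\<mu> a - \<nu> a\<bar> < \<epsilon>" using near by blast
    moreover from this have "\<mu> a \<le> (\<Sum>i<n. norm (a i))" by (simp add: coef_seminorm_def)
    ultimately show "\<nu> a \<le> (\<Sum>i<n. norm (a i)) + \<epsilon>" by linarith
  qed
qed

section \<open>From strategies to the asymptotic structure and back to vectors\<close>

context schauder_space
begin

lemma lincomb_unit_coef: "i < length xs \<Longrightarrow> lincomb xs (unit_coef i) = xs ! i"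
proof -
  assume i: "i < length xs"
  have "lincomb xs (unit_coef i) = (\<Sum>j<length xs. if j = i then xs ! i else 0)"
    unfolding lincomb_def by (rule sum.cong) (auto simp: unit_coef_def)
  then show ?thesis using i by simp
qed

text \<open>\<open>\<nu>\<close> is a cluster point of the norms of outcomes as functions of the
  coefficients. Membership needs closeness for all coefficients at once, which the finite net
  extracts from closeness at finitely many. The last conclusion keeps \<open>P\<close>, so that
  estimates for \<open>\<nu>\<close> can be carried back to outcomes satisfying
  \<open>P\<close>.\<close>

lemma asymptotic_structure_member:
  assumes "\<And>ys. P ys \<Longrightarrow> length ys = n"
    and "\<And>ys y. P ys \<Longrightarrow> y \<in> set ys \<Longrightarrow> norm y = 1"
    and "\<And>ys. P ys \<Longrightarrow> coef_bound D ys"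
    and "0 < D" and "asym_game scl e n P []"
  obtains \<nu> where "coef_seminorm n \<nu>"
    "in_asym_structure scl e n (\<lambda>c f j. c * f j) \<nu> unit_coef"
    "\<And>\<eta>. 0 < \<eta> \<Longrightarrow> asym_game scl e n (\<lambda>ys. P ys \<and> (\<forall>a. \<bar>norm (lincomb ys a) - \<nu> a\<bar> \<le> \<eta> * \<nu> a)) []"
proof -
  define \<phi> where "\<phi> ys = (\<lambda>a. norm (lincomb ys a))" for ys
  have semi: "coef_seminorm n (\<phi> ys)" if "P ys" for ys
    using coef_seminorm_lincomb[of ys] assms(1,2)[OF that] by (simp add: \<phi>_def)
  have "\<exists>\<nu>\<in>{\<mu>. \<forall>a. 0 \<le> \<mu> a \<and> \<mu> a \<le> (\<Sum>i<n. norm (a i))}. \<forall>U. open U \<and> \<nu> \<in> U \<longrightarrow>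
      asym_game scl e n (\<lambda>ys. P ys \<and> \<phi> ys \<in> U) []"
    using semi by (intro asym_game_cluster_point[OF assms(5) compact_Collect_fun_Icc])
      (auto simp: coef_seminorm_def)
  then obtain \<nu> where \<nu>: "\<And>U. open U \<Longrightarrow> \<nu> \<in> U \<Longrightarrow> asym_game scl e n (\<lambda>ys. P ys \<and> \<phi> ys \<in> U) []"
    by blast
  have near: "asym_game scl e n (\<lambda>ys. P ys \<and> (\<forall>a\<in>A. \<bar>\<phi> ys a - \<nu> a\<bar> < \<delta>)) []"
    if "finite A" "0 < \<delta>" for A \<delta>
    using \<nu>[OF open_fun_near[OF that(1), of \<nu> \<delta>]] that(2) by simp
  have near_ex: "\<exists>ys. P ys \<and> (\<forall>a\<in>A. \<bar>\<phi> ys a - \<nu> a\<bar> < \<delta>)" if "finite A" "0 < \<delta>" for A \<delta>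
    using asym_game_ex[OF near[OF that]] by blast
  have \<nu>_semi: "coef_seminorm n \<nu>"
    by (rule coef_seminorm_pointwise_limit) (use near_ex semi in blast)
  have \<nu>_bound: "norm (a i) \<le> D * \<nu> a" if "i < n" for a i
  proof (rule field_le_epsilon)
    fix \<epsilon> :: real assume "0 < \<epsilon>"
    then obtain ys where ys: "P ys" "\<bar>\<phi> ys a - \<nu> a\<bar> < \<epsilon> / D"
      using near_ex[of "{a}" "\<epsilon> / D"] \<open>0 < D\<close> by auto
    have "norm (a i) \<le> D * \<phi> ys a"
      using assms(1,3)[OF ys(1)] that by (simp add: coef_bound_def \<phi>_def)
    also have "\<dots> \<le> D * (\<nu> a + \<epsilon> / D)"
      using ys(2) \<open>0 < D\<close> by (intro mult_left_mono) auto
    finally show "norm (a i) \<le> D * \<nu> a + \<epsilon>"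
      using \<open>0 < D\<close> by (simp add: distrib_left)
  qed
  have uniform: "asym_game scl e n (\<lambda>ys. P ys \<and> (\<forall>a. \<bar>norm (lincomb ys a) - \<nu> a\<bar> \<le> \<eta> * \<nu> a)) []"
    if "0 < \<eta>" for \<eta>
  proof -
    obtain A :: "(nat \<Rightarrow> 'k) set" and \<delta> where "finite A" "0 < \<delta>" and
      A: "\<And>\<mu> \<nu> a. coef_seminorm n \<mu> \<Longrightarrow> coef_seminorm n \<nu> \<Longrightarrow>
      (\<And>a i. i < n \<Longrightarrow> norm (a i) \<le> D * \<nu> a) \<Longrightarrow> (\<And>a. a \<in> A \<Longrightarrow> \<bar>\<mu> a - \<nu> a\<bar> < \<delta>) \<Longrightarrow>
      \<bar>\<mu> a - \<nu> a\<bar> \<le> \<eta> * \<nu> a"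
      using finite_net_coef_seminorm[OF \<open>0 < D\<close> \<open>0 < \<eta>\<close>, of n] by metis
    show ?thesis
    proof (rule asym_game_mono[OF near[OF \<open>finite A\<close> \<open>0 < \<delta>\<close>]])
      fix ys assume ys: "P ys \<and> (\<forall>a\<in>A. \<bar>\<phi> ys a - \<nu> a\<bar> < \<delta>)"
      have "\<bar>\<phi> ys a - \<nu> a\<bar> \<le> \<eta> * \<nu> a" for a
        by (rule A[OF semi \<nu>_semi \<nu>_bound]) (use ys in auto)
      with ys show "P ys \<and> (\<forall>a. \<bar>norm (lincomb ys a) - \<nu> a\<bar> \<le> \<eta> * \<nu> a)"
        by (simp add: \<phi>_def)
    qed
  qed
  have trunc: "\<nu> (\<Sum>i<n. (\<lambda>j. a i * unit_coef i j)) = \<nu> a" for a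
    using coef_seminorm_diff_le[OF \<nu>_semi, of "\<lambda>j. if j < n then a j else 0" a]
    by (simp add: sum_unit_coef)
  have \<nu>_unit: "\<nu> (unit_coef i) = 1" if "i < n" for i
  proof -
    have "\<bar>\<nu> (unit_coef i) - 1\<bar> \<le> 0"
    proof (rule field_le_epsilon)
      fix \<epsilon> :: real assume "0 < \<epsilon>"
      then obtain ys where ys: "P ys" "\<bar>\<phi> ys (unit_coef i) - \<nu> (unit_coef i)\<bar> < \<epsilon>"
        using near_ex[of "{unit_coef i}" \<epsilon>] by auto
      have "\<phi> ys (unit_coef i) = 1"
        using assms(1,2)[OF ys(1)] that by (simp add: \<phi>_def lincomb_unit_coef)
      with ys(2) show "\<bar>\<nu> (unit_coef i) - 1\<bar> \<le> 0 + \<epsilon>" by linarith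
    qed
    then show ?thesis by simp
  qed
  have "asym_game scl e n
        (\<lambda>xs. \<exists>c C. 0 < c \<and> c \<le> C \<and> C / c < 1 + \<epsilon> \<and>
           (\<forall>a. c * \<nu> (\<Sum>i<n. (\<lambda>j. a i * unit_coef i j)) \<le> norm (\<Sum>i<n. scl (a i) (xs ! i)) \<and>
              norm (\<Sum>i<n. scl (a i) (xs ! i)) \<le> C * \<nu> (\<Sum>i<n. (\<lambda>j. a i * unit_coef i j)))) []"
    if "0 < \<epsilon>" for \<epsilon> :: real
  proof -
    \<comment> \<open>With this choice \<open>(1 + \<eta>) / (1 - \<eta>)\<close> equals
      \<open>1 + \<epsilon> / 2\<close>.\<close>
    define \<eta> where "\<eta> = \<epsilon> / (4 + \<epsilon>)"
    have \<eta>: "0 < \<eta>" "\<eta> < 1" using that by (auto simp: \<eta>_def)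
    show ?thesis
    proof (rule asym_game_mono[OF uniform[OF \<eta>(1)]], intro exI conjI allI)
      fix ys a assume ys: "P ys \<and> (\<forall>a. \<bar>norm (lincomb ys a) - \<nu> a\<bar> \<le> \<eta> * \<nu> a)"
      then have "\<bar>norm (lincomb ys a) - \<nu> a\<bar> \<le> \<eta> * \<nu> a" "length ys = n"
        using assms(1) by auto
      then show "(1 - \<eta>) * \<nu> (\<Sum>i<n. (\<lambda>j. a i * unit_coef i j)) \<le> norm (\<Sum>i<n. scl (a i) (ys ! i))"
        "norm (\<Sum>i<n. scl (a i) (ys ! i)) \<le> (1 + \<eta>) * \<nu> (\<Sum>i<n. (\<lambda>j. a i * unit_coef i j))"
        unfolding trunc lincomb_def by (auto simp: abs_le_iff algebra_simps)
    next
      show "(1 + \<eta>) / (1 - \<eta>) < 1 + \<epsilon>"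
        using that by (simp add: \<eta>_def field_simps add_pos_pos)
    qed (use \<eta> in auto)
  qed
  then have "in_asym_structure scl e n (\<lambda>c f j. c * f j) \<nu> unit_coef"
    unfolding in_asym_structure_def
    using \<nu>_unit \<nu>_bound is_norm_on_unit_coef_span[OF \<nu>_semi]
    by (intro conjI allI impI vector_space_pointwise inj_unit_coef independent_unit_coef) blast+
  with \<nu>_semi uniform show ?thesis using that by blast
qed

text \<open>Transfers the hypothesis from members of the asymptotic structure to actual vectors that
  satisfy any invariant \<open>Q\<close> the vector player can maintain. The constant is chosen
  before \<open>Q\<close> and \<open>n\<close>; the later comparison of growth rates rests on
  this.\<close>

lemma asymptotic_lp_vectors:
  assumes "asymptotic_lp scl e p"
  obtains C where "0 < C"
    "\<And>Q n. Q [] \<Longrightarrow> (\<And>ys m. Q ys \<Longrightarrow> \<exists>x. norm x = 1 \<and> beyond scl e m x \<and> Q (ys @ [x])) \<Longrightarrow> 1 \<le> n \<Longrightarrow>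
      \<exists>ys. length ys = n \<and> Q ys \<and> (\<forall>a. lp_norm p n a \<le> C * norm (lincomb ys a) \<and>
        norm (lincomb ys a) \<le> C * lp_norm p n a)"
proof -
  obtain C where C: "0 < C" "\<And>n N (b :: nat \<Rightarrow> nat \<Rightarrow> 'k) a. 1 \<le> n \<Longrightarrow>
      in_asym_structure scl e n (\<lambda>c f j. c * f j) N b \<Longrightarrow>
      1 / C * lp_norm p n a \<le> N (\<Sum>i<n. (\<lambda>j. a i * b i j)) \<and>
      N (\<Sum>i<n. (\<lambda>j. a i * b i j)) \<le> C * lp_norm p n a"
    using assms unfolding asymptotic_lp_def by blast
  obtain K where K: "1 \<le> K" "\<And>m x. norm (proj m x) \<le> K * norm x"
    by (rule basis_constant) blast
  show ?thesis
  \<comment> \<open>An outcome within relative error 1/2 of the member loses at most a factor 2 in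
    either direction.\<close>
  proof (rule that[of "2 * C"])
    fix Q and n :: nat
    assume Q: "Q []" "\<And>ys m. Q ys \<Longrightarrow> \<exists>x. norm x = 1 \<and> beyond scl e m x \<and> Q (ys @ [x])"
      and n: "1 \<le> n"
    define L where "L = 1 + 2 * K"
    have L: "1 \<le> L" using K by (simp add: L_def)
    \<comment> \<open>The coefficient bound deteriorates by a factor \<open>L\<close> in each round.
      This is harmless, because it is used for one fixed \<open>n\<close> and does not enter the
      final constant.\<close>
    define R where "R ys \<longleftrightarrow> Q ys \<and> (\<forall>y\<in>set ys. norm y = 1) \<and> coef_bound (L ^ length ys) ys" for ys
    have "asym_game scl e n (\<lambda>ys. R ys \<and> length ys = length ([] :: 'a list) + n) []"
    proof (rule asym_game_strategy[where R = R and xs = "[]"])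
      show "R []" using Q by (simp add: R_def coef_bound_def)
      show "\<exists>x. beyond scl e m x \<and> R (ys @ [x])" if "R ys" for ys m
      proof -
        have "1 \<le> L ^ length ys" "coef_bound (L ^ length ys) ys"
          using that L by (simp_all add: R_def)
        then obtain M where M: "\<And>x. norm x = 1 \<Longrightarrow> beyond scl e M x \<Longrightarrow>
            coef_bound ((1 + 2 * K) * L ^ length ys) (ys @ [x])"
          by (rule coef_bound_snoc[OF K]) blast
        obtain x where x: "norm x = 1" "beyond scl e (max m M) x" "Q (ys @ [x])"
          using Q(2) \<open>R ys\<close> unfolding R_def by blast
        moreover have "beyond scl e m x" "beyond scl e M x"
          using x(2) by (auto intro: beyond_mono)
        ultimately show ?thesis
          using M[of x] that by (intro exI[of _ x]) (auto simp: R_def L_def)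
      qed
    qed
    then have game: "asym_game scl e n (\<lambda>ys. R ys \<and> length ys = n) []" by simp
    obtain \<nu> where \<nu>: "coef_seminorm n \<nu>"
      "in_asym_structure scl e n (\<lambda>c f j. c * f j) \<nu> unit_coef"
      "\<And>\<eta>. 0 < \<eta> \<Longrightarrow> asym_game scl e n (\<lambda>ys. (R ys \<and> length ys = n) \<and>
        (\<forall>a. \<bar>norm (lincomb ys a) - \<nu> a\<bar> \<le> \<eta> * \<nu> a)) []"
      by (rule asymptotic_structure_member[OF _ _ _ _ game, of "L ^ n"])
        (use L in \<open>auto simp: R_def\<close>)
    obtain ys where ys: "R ys" "length ys = n" "\<And>a. \<bar>norm (lincomb ys a) - \<nu> a\<bar> \<le> 1 / 2 * \<nu> a"
      using asym_game_ex[OF \<nu>(3)[of "1/2"]] by auto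
    have "lp_norm p n a \<le> 2 * C * norm (lincomb ys a) \<and> norm (lincomb ys a) \<le> 2 * C * lp_norm p n a" for a
    proof -
      have "\<nu> (\<Sum>i<n. (\<lambda>j. a i * unit_coef i j)) = \<nu> a"
        using coef_seminorm_diff_le[OF \<nu>(1), of "\<lambda>j. if j < n then a j else 0" a]
        by (simp add: sum_unit_coef)
      then have lp: "lp_norm p n a \<le> C * \<nu> a" "\<nu> a \<le> C * lp_norm p n a"
        using C(2)[OF n \<nu>(2), of a] C(1) by (auto simp: field_simps)
      have "\<nu> a \<le> 2 * norm (lincomb ys a)" "norm (lincomb ys a) \<le> 2 * \<nu> a"
        using ys(3)[of a] abs_ge_zero[of "norm (lincomb ys a) - \<nu> a"] by linarith+
      moreover from this(1) have "C * \<nu> a \<le> C * (2 * norm (lincomb ys a))"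
        using C(1) by (intro mult_left_mono) auto
      ultimately show ?thesis
        using lp by simp
    qed
    with ys show "\<exists>ys. length ys = n \<and> Q ys \<and> (\<forall>a. lp_norm p n a \<le> 2 * C * norm (lincomb ys a) \<and>
        norm (lincomb ys a) \<le> 2 * C * lp_norm p n a)"
      by (auto simp: R_def)
  qed (use C in simp)
qed

end

subsection \<open>Flat vectors in subspaces of small codimension\<close>

text \<open>Gaussian elimination: equation \<open>m\<close> is solved for an unknown
  \<open>q\<close> with nonzero coefficient and substituted into the others. The index type is left
  open because the unknowns are labelled by numbers in one application and by vectors of a subspace
  in another.\<close>

lemma ex_kernel_vector:
  fixes g :: "nat \<Rightarrow> 'i \<Rightarrow> 'k::field"
  assumes "finite I" "m < card I"
  shows "\<exists>w. (\<exists>i\<in>I. w i \<noteq> 0) \<and> (\<forall>i. i \<notin> I \<longrightarrow> w i = 0) \<and> (\<forall>j<m. (\<Sum>i\<in>I. w i * g j i) = 0)"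
  using assms
proof (induction m arbitrary: I g)
  case 0
  then obtain i where "i \<in> I" by fastforce
  then show ?case by (intro exI[of _ "\<lambda>j. if j = i then 1 else 0"]) auto
next
  case (Suc m)
  show ?case
  proof (cases "\<forall>i\<in>I. g m i = 0")
    case True
    with Suc.IH[of I g] Suc.prems show ?thesis
      by (auto simp: less_Suc_eq)
  next
    case False
    then obtain q where q: "q \<in> I" "g m q \<noteq> 0" by blast
    let ?J = "I - {q}"
    define h where "h j i = g j i - g j q * g m i / g m q" for j i
    have "m < card ?J" using Suc.prems q by simp
    then obtain w where w: "\<exists>i\<in>?J. w i \<noteq> 0" "\<And>i. i \<notin> ?J \<Longrightarrow> w i = 0"
      "\<And>j. j < m \<Longrightarrow> (\<Sum>i\<in>?J. w i * h j i) = 0"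
      using Suc.IH[of ?J h] Suc.prems by auto
    define S where "S j = (\<Sum>i\<in>?J. w i * g j i)" for j
    define v where "v = w(q := - S m / g m q)"
    have v_sum: "(\<Sum>i\<in>I. v i * g j i) = S j - S m / g m q * g j q" for j
    proof -
      have "(\<Sum>i\<in>?J. v i * g j i) = S j"
        unfolding S_def by (rule sum.cong) (auto simp: v_def)
      then show ?thesis
        using Suc.prems q by (subst sum.remove[of _ q]) (auto simp: v_def)
    qed
    have "S j = S m / g m q * g j q" if "j < m" for j
    proof -
      have "(\<Sum>i\<in>?J. w i * h j i) = S j - g j q / g m q * S m"
        by (simp add: h_def S_def sum_distrib_left sum_subtractf right_diff_distrib mult_ac)
      then show ?thesis using w(3)[OF that] by (simp add: mult_ac)
    qed
    then have "(\<Sum>i\<in>I. v i * g j i) = 0" if "j < Suc m" for j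
      using that q by (cases "j = m") (auto simp: v_sum less_Suc_eq)
    moreover have "\<exists>i\<in>I. v i \<noteq> 0" "\<forall>i. i \<notin> I \<longrightarrow> v i = 0"
      using w(1,2) q by (auto simp: v_def)
    ultimately show ?thesis by blast
  qed
qed

text \<open>At parameter \<open>2 / norm w\<close> the norm is at least 1, so the sphere is met by
  the intermediate value theorem; before that point convexity keeps the segment in the ball. The
  parameter serves as the exit time of one coordinate.\<close>

lemma ex_norm_eq_1_on_ray:
  fixes z w :: "'k::real_normed_vector"
  assumes "norm z \<le> 1" "w \<noteq> 0"
  shows "\<exists>s\<ge>0. norm (z + s *\<^sub>R w) = 1 \<and> (\<forall>r. 0 \<le> r \<and> r \<le> s \<longrightarrow> norm (z + r *\<^sub>R w) \<le> 1)"
proof -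
  let ?S = "2 / norm w"
  have "norm (?S *\<^sub>R w) - norm z \<le> norm (z + ?S *\<^sub>R w)"
    by (metis add.commute norm_diff_ineq)
  then have "1 \<le> norm (z + ?S *\<^sub>R w)"
    using assms by simp
  moreover have "continuous_on {0..?S} (\<lambda>s. norm (z + s *\<^sub>R w))"
    by (intro continuous_intros)
  ultimately obtain s where s: "0 \<le> s" "norm (z + s *\<^sub>R w) = 1"
    using IVT'[of "\<lambda>s. norm (z + s *\<^sub>R w)" 0 1 ?S] assms by auto
  have "norm (z + r *\<^sub>R w) \<le> 1" if "0 \<le> r" "r \<le> s" for r
  proof (cases "s = 0")
    case False
    define u where "u = r / s"
    have u: "0 \<le> u" "u \<le> 1" "u * s = r" using that s False by (auto simp: u_def)
    have "z + r *\<^sub>R w = (1 - u) *\<^sub>R z + u *\<^sub>R (z + s *\<^sub>R w)"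
      using u(3) by (simp add: algebra_simps)
    also have "norm \<dots> \<le> (1 - u) * norm z + u * norm (z + s *\<^sub>R w)"
      using u by (intro order_trans[OF norm_triangle_ineq]) auto
    also have "\<dots> \<le> (1 - u) * 1 + u * 1"
      using u assms s by (intro add_mono mult_left_mono) auto
    finally show ?thesis by simp
  qed (use that assms in auto)
  with s show ?thesis by blast
qed

text \<open>This is the fact that an extreme point of the unit ball of an \<open>m\<close>-codimensional subspace of
  \<open>\<ell>\<^sub>\<infinity>\<^sup>n\<close> has at most \<open>m\<close> coordinates of modulus less than \<open>1\<close>.\<close>

lemma ex_flat_kernel_vector:
  fixes g :: "nat \<Rightarrow> nat \<Rightarrow> 'k::real_normed_field"
  shows "\<exists>z. (\<forall>i<n. norm (z i) \<le> 1) \<and> card {i. i < n \<and> norm (z i) \<noteq> 1} \<le> m \<and>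
    (\<forall>j<m. (\<Sum>i<n. z i * g j i) = 0)"
proof -
  define Q where "Q z \<longleftrightarrow> (\<forall>i<n. norm (z i) \<le> 1) \<and> (\<forall>j<m. (\<Sum>i<n. z i * g j i) = 0)" for z
  define I where "I z = {i. i < n \<and> norm (z i) \<noteq> 1}" for z :: "nat \<Rightarrow> 'k"
  have "Q (\<lambda>_. 0)" by (simp add: Q_def)
  \<comment> \<open>Minimality of the number of coordinates off the unit sphere replaces
    extremality.\<close>
  then obtain z where z: "Q z" and min: "\<And>y. Q y \<Longrightarrow> card (I z) \<le> card (I y)"
    using ex_has_least_nat[of Q "\<lambda>_. 0" "\<lambda>z. card (I z)"] by blast
  have fin: "finite (I y)" for y by (simp add: I_def)
  have "card (I z) \<le> m"
  proof (rule ccontr)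
    assume "\<not> ?thesis"
    then obtain w where w: "\<exists>i\<in>I z. w i \<noteq> 0" "\<And>i. i \<notin> I z \<Longrightarrow> w i = 0"
      "\<And>j. j < m \<Longrightarrow> (\<Sum>i\<in>I z. w i * g j i) = 0"
      using ex_kernel_vector[OF fin, of m z g] by auto
    have w_sum: "(\<Sum>i<n. w i * g j i) = 0" if "j < m" for j
      using w(3)[OF that] w(2) by (subst sum.mono_neutral_right[of _ "I z"]) (auto simp: I_def)
    define J where "J = {i \<in> I z. w i \<noteq> 0}"
    have J: "finite J" "J \<noteq> {}" using w(1) fin by (auto simp: J_def)
    have "\<exists>s\<ge>0. norm (z i + s *\<^sub>R w i) = 1 \<and> (\<forall>r. 0 \<le> r \<and> r \<le> s \<longrightarrow> norm (z i + r *\<^sub>R w i) \<le> 1)"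
      if "i \<in> J" for i
      using z that by (intro ex_norm_eq_1_on_ray) (auto simp: J_def I_def Q_def)
    then obtain s where s: "\<And>i. i \<in> J \<Longrightarrow> 0 \<le> s i" "\<And>i. i \<in> J \<Longrightarrow> norm (z i + s i *\<^sub>R w i) = 1"
      "\<And>i r. i \<in> J \<Longrightarrow> 0 \<le> r \<Longrightarrow> r \<le> s i \<Longrightarrow> norm (z i + r *\<^sub>R w i) \<le> 1"
      by metis
    \<comment> \<open>The earliest exit time: moving along \<open>w\<close> for this long leaves no
      coordinate outside the ball and puts coordinate \<open>q\<close> on the sphere. Coordinates
      already there stay fixed, since \<open>w\<close> vanishes on them.\<close>
    obtain q where q: "q \<in> J" "\<And>i. i \<in> J \<Longrightarrow> s q \<le> s i"
      using ex_min_if_finite[of "s ` J"] J by (fastforce simp: not_less)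
    define y where "y i = z i + s q *\<^sub>R w i" for i
    have "norm (y i) \<le> 1" if "i < n" for i
    proof (cases "i \<in> J")
      case True
      then show ?thesis using s q by (simp add: y_def)
    next
      case False
      then have "w i = 0" using w(2) by (auto simp: J_def)
      then show ?thesis using z that by (simp add: y_def Q_def)
    qed
    moreover have "(\<Sum>i<n. y i * g j i) = 0" if "j < m" for j
    proof -
      have "(\<Sum>i<n. y i * g j i) = (\<Sum>i<n. z i * g j i) + s q *\<^sub>R (\<Sum>i<n. w i * g j i)"
        by (simp add: y_def distrib_right sum.distrib scaleR_sum_right)
      then show ?thesis using z w_sum that by (simp add: Q_def)
    qed
    ultimately have "Q y" by (simp add: Q_def)
    moreover have "I y \<subset> I z"
    proof
      show "I y \<subseteq> I z"
        using w(2) by (force simp: I_def y_def)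
      show "I y \<noteq> I z"
        using q(1) s(2) by (force simp: I_def y_def J_def)
    qed
    ultimately show False
      using min psubset_card_mono[OF fin] by (metis not_le)
  qed
  with z show ?thesis by (auto simp: Q_def I_def)
qed

text \<open>Supplies the vector at which a Euclidean norm almost touches \<open>N\<close>, as an
  almost extremal point of a quotient of the two; the factor \<open>1 + \<eta>\<close> is the price
  for avoiding compactness of a sphere.\<close>

lemma ex_almost_maximizer:
  fixes f :: "'b \<Rightarrow> real"
  assumes "x \<in> A" "\<And>x. x \<in> A \<Longrightarrow> 0 < f x" "\<And>x. x \<in> A \<Longrightarrow> f x \<le> B" "0 < \<eta>"
  shows "\<exists>a\<in>A. \<forall>x\<in>A. f x \<le> (1 + \<eta>) * f a"
proof -
  let ?S = "Sup (f ` A)"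
  have bdd: "bdd_above (f ` A)" using assms by (auto simp: bdd_above_def)
  have "0 < ?S" using assms bdd by (meson cSUP_upper less_le_trans)
  then have "?S / (1 + \<eta>) < ?S" using \<open>0 < \<eta>\<close> by (simp add: field_simps)
  then obtain a where "a \<in> A" "?S / (1 + \<eta>) < f a"
    using less_cSUP_iff[OF _ bdd] \<open>x \<in> A\<close> by blast
  moreover have "f x \<le> ?S" if "x \<in> A" for x using bdd that by (rule cSUP_upper[rotated])
  ultimately show ?thesis
    using \<open>0 < \<eta>\<close> by (intro bexI[of _ a]) (auto simp: field_simps intro: order_trans less_imp_le)
qed

subsection \<open>Comparison of \<open>\<ell>\<^sub>p\<^sup>n\<close> with \<open>\<ell>\<^sub>2\<^sup>n\<close>\<close>

text \<open>Jensen's inequality for the concave power \<open>\<alpha>\<close>, obtained from Young's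
  inequality for each term and the average \<open>A\<close>.\<close>

lemma sum_powr_le_card_powr:
  fixes x :: "nat \<Rightarrow> real"
  assumes "0 < \<alpha>" "\<alpha> \<le> 1" "1 \<le> n" "\<And>i. i < n \<Longrightarrow> 0 \<le> x i"
  shows "(\<Sum>i<n. x i powr \<alpha>) \<le> real n * ((\<Sum>i<n. x i) / real n) powr \<alpha>"
proof (cases "\<forall>i<n. x i = 0")
  case False
  define A where "A = (\<Sum>i<n. x i) / real n"
  have "(\<Sum>i<n. x i) \<noteq> 0"
    using False assms(4) by (subst sum_nonneg_eq_0_iff) auto
  then have "0 < (\<Sum>i<n. x i)"
    using assms(4) by (intro order.not_eq_order_implies_strict sum_nonneg) auto
  then have A: "0 < A" using assms by (simp add: A_def)
  have "x i powr \<alpha> * A powr (1 - \<alpha>) \<le> \<alpha> * x i + (1 - \<alpha>) * A" if "i < n" for i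
  proof (cases "x i = 0")
    case False
    then show ?thesis
      using assms that A by (intro Youngs_inequality_0) (auto simp: less_le)
  qed (use A assms in auto)
  then have "(\<Sum>i<n. x i powr \<alpha>) * A powr (1 - \<alpha>) \<le> (\<Sum>i<n. \<alpha> * x i + (1 - \<alpha>) * A)"
    unfolding sum_distrib_right by (intro sum_mono) auto
  also have "\<dots> = \<alpha> * (\<Sum>i<n. x i) + real n * ((1 - \<alpha>) * A)"
    by (simp add: sum.distrib sum_distrib_left)
  also have "(\<Sum>i<n. x i) = real n * A"
    using assms by (simp add: A_def)
  also have "\<alpha> * (real n * A) + real n * ((1 - \<alpha>) * A) = real n * A"
    by (simp add: algebra_simps)
  also have "\<dots> = real n * A powr \<alpha> * A powr (1 - \<alpha>)"
    using A by (simp add: powr_add[symmetric])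
  finally show ?thesis
    using A unfolding A_def[symmetric] by simp
qed (use assms in simp)

lemma ex_powr_gt:
  fixes K :: real
  assumes "0 < \<delta>"
  shows "\<exists>n\<ge>1. K < real n powr \<delta>"
proof -
  obtain n :: nat where n: "(\<bar>K\<bar> + 1) powr (1 / \<delta>) \<le> real n"
    using real_arch_simple by blast
  then have "((\<bar>K\<bar> + 1) powr (1 / \<delta>)) powr \<delta> \<le> real n powr \<delta>"
    using assms by (intro powr_mono2) auto
  then have "\<bar>K\<bar> + 1 \<le> real n powr \<delta>"
    using assms by (simp add: powr_powr)
  moreover from this have "1 \<le> n" using assms by (cases n) auto
  ultimately show ?thesis by (intro exI[of _ n]) auto
qed

definition recip :: "ereal \<Rightarrow> real" where
  "recip p = (if p = \<infinity> then 0 else 1 / real_of_ereal p)"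

lemma recip_cases:
  assumes "1 \<le> (p::ereal)"
  obtains "p = \<infinity>" "recip p = 0" | r where "p = ereal r" "1 \<le> r" "recip p = 1 / r" "real_of_ereal p = r"
  using assms by (cases p) (auto simp: recip_def)

lemma recip_gt_half:
  assumes "1 \<le> p" "p < 2"
  shows "1 / 2 < recip p"
  using assms(1)
proof (cases rule: recip_cases)
  case (2 r)
  then show ?thesis using assms(2) by (simp add: frac_less2)
qed (use assms in simp)

lemma recip_lt_half: "2 < p \<Longrightarrow> recip p < 1 / 2"
  by (cases p) (auto simp: recip_def frac_less2)

lemma lp_norm_const_1:
  assumes "1 \<le> p" "1 \<le> n"
  shows "lp_norm p n (\<lambda>_. 1 :: 'k::real_normed_field) = real n powr recip p"
  using assms(1)
proof (cases rule: recip_cases)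
  case 1
  have "(\<lambda>i. norm (1::'k)) ` {..<n} = {1}" using assms by (simp add: image_constant_conv lessThan_empty_iff)
  then show ?thesis using 1 assms by (simp add: lp_norm_def)
next
  case (2 r)
  then show ?thesis by (simp add: lp_norm_def)
qed

lemma lp_norm_nonneg:
  assumes "1 \<le> n"
  shows "0 \<le> lp_norm p n a"
proof (cases "p = \<infinity>")
  case True
  have "norm (a 0) \<le> Max ((\<lambda>i. norm (a i)) ` {..<n})"
    using assms by (intro Max_ge) auto
  then show ?thesis
    using True norm_ge_zero[of "a 0"] by (simp add: lp_norm_def del: norm_ge_zero)
qed (simp add: lp_norm_def)

lemma lp_norm_le_of_norm_le_1:
  assumes "1 \<le> p" "1 \<le> n" "\<And>i. i < n \<Longrightarrow> norm (z i) \<le> 1"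
  shows "lp_norm p n z \<le> real n powr recip p"
  using assms(1)
proof (cases rule: recip_cases)
  case 1
  have "Max ((\<lambda>i. norm (z i)) ` {..<n}) \<le> 1"
    using assms by (subst Max_le_iff) (auto simp: lessThan_empty_iff)
  then show ?thesis using 1 assms by (simp add: lp_norm_def)
next
  case (2 r)
  have "(\<Sum>i<n. norm (z i) powr r) \<le> (\<Sum>i<n. 1)"
    using assms 2 by (intro sum_mono powr_le1) auto
  then show ?thesis
    using 2 by (auto simp: lp_norm_def intro!: powr_mono2 sum_nonneg)
qed

text \<open>At least \<open>n - m\<close> terms equal 1 and the others are nonnegative.
  \<open>h\<close> covers both the square and the power with exponent \<open>p\<close>.\<close>

lemma sum_indicator_flat_ge:
  fixes f :: "nat \<Rightarrow> real"
  assumes "2 * m \<le> n" "card {i. i < n \<and> f i \<noteq> 1} \<le> m"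
    and "\<And>x. 0 \<le> h x" "h 1 = 1"
  shows "real n / 2 \<le> (\<Sum>i<n. h (f i))"
proof -
  let ?J = "{..<n} - {i. i < n \<and> f i \<noteq> 1}"
  have "n - m \<le> card ?J"
    using assms by (subst card_Diff_subset) auto
  then have "real n / 2 \<le> real (card ?J)"
    using assms by linarith
  also have "\<dots> = (\<Sum>i\<in>?J. h (f i))"
    using assms by simp
  also have "\<dots> \<le> (\<Sum>i<n. h (f i))"
    using assms by (intro sum_mono2) auto
  finally show ?thesis .
qed

lemma lp_norm_flat_ge:
  assumes "1 \<le> p" "p < \<infinity>" "2 * m \<le> n" "card {i. i < n \<and> norm (z i) \<noteq> 1} \<le> m"
  shows "real n powr recip p / 2 \<le> lp_norm p n z"
proof -
  obtain r where r: "p = ereal r" "1 \<le> r" "recip p = 1 / r" "real_of_ereal p = r"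
    using assms by (cases rule: recip_cases) auto
  have "(1/2 :: real) \<le> (1/2) powr (1 / r)"
    using r powr_mono'[of "1 / r" 1 "1/2"] by simp
  then have "real n powr (1 / r) / 2 \<le> real n powr (1 / r) * (1/2) powr (1 / r)"
    using mult_left_mono[of "1/2" "(1/2) powr (1 / r)" "real n powr (1 / r)"] by simp
  also have "\<dots> = (real n / 2) powr (1 / r)"
    by (simp add: powr_mult[symmetric])
  also have "\<dots> \<le> (\<Sum>i<n. norm (z i) powr r) powr (1 / r)"
    using sum_indicator_flat_ge[OF assms(3,4), of "\<lambda>x. x powr r"] r by (intro powr_mono2) auto
  finally show ?thesis using r by (simp add: lp_norm_def)
qed

text \<open>Power mean inequality for the exponents \<open>p\<close> and 2. Equality holds when all
  moduli agree, which is why it can be reversed up to a constant on flat sequences.\<close>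

lemma lp_norm_sq_le:
  fixes a :: "nat \<Rightarrow> 'k::real_normed_field"
  assumes "1 \<le> p" "p < 2" "1 \<le> n"
  shows "(lp_norm p n a)\<^sup>2 \<le> real n powr (2 * recip p - 1) * (\<Sum>i<n. (norm (a i))\<^sup>2)"
proof -
  obtain r where r: "p = ereal r" "1 \<le> r" "recip p = 1 / r" "real_of_ereal p = r"
    using assms by (cases rule: recip_cases) auto
  have "r < 2" using assms r by simp
  define S where "S = (\<Sum>i<n. (norm (a i))\<^sup>2)"
  have S: "0 \<le> S" by (simp add: S_def sum_nonneg)
  have "norm (a i) powr r = ((norm (a i))\<^sup>2) powr (r / 2)" for i
    using powr_powr[of "norm (a i)" 2 "r / 2"] by simp
  then have "(\<Sum>i<n. norm (a i) powr r) \<le> real n * (S / real n) powr (r / 2)"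
    unfolding S_def using sum_powr_le_card_powr[of "r / 2" n "\<lambda>i. (norm (a i))\<^sup>2"] r \<open>r < 2\<close> assms by simp
  then have "(\<Sum>i<n. norm (a i) powr r) powr (2 / r) \<le> (real n * (S / real n) powr (r / 2)) powr (2 / r)"
    using r by (intro powr_mono2) (auto intro: sum_nonneg)
  also have "\<dots> = real n powr (2 / r) * (S / real n)"
    using r S assms by (simp add: powr_mult powr_powr)
  also have "\<dots> = real n powr (2 / r - 1) * S"
    using assms by (simp add: powr_diff)
  also have "(\<Sum>i<n. norm (a i) powr r) powr (2 / r) = (lp_norm p n a)\<^sup>2"
    using r by (simp add: lp_norm_def power2_eq_square powr_add[symmetric])
  finally show ?thesis using r by (simp add: S_def)
qed

text \<open>For finite \<open>p\<close> this is the power mean inequality with the exponents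
  exchanged; for infinite \<open>p\<close> each modulus is at most the maximum.\<close>

lemma lp_norm_sq_ge:
  fixes a :: "nat \<Rightarrow> 'k::real_normed_field"
  assumes "2 < p" "1 \<le> n"
  shows "real n powr (2 * recip p - 1) * (\<Sum>i<n. (norm (a i))\<^sup>2) \<le> (lp_norm p n a)\<^sup>2"
proof -
  have "1 \<le> p" using assms by (cases p) auto
  then show ?thesis
  proof (cases rule: recip_cases)
    case 1
    have "(\<Sum>i<n. (norm (a i))\<^sup>2) \<le> (\<Sum>i<n. (lp_norm p n a)\<^sup>2)"
      using 1 by (intro sum_mono power_mono) (auto simp: lp_norm_def)
    then show ?thesis
      using 1 assms by (simp add: powr_minus field_simps)
  next
    case (2 r)
    then have "2 < r" using assms by simp
    define W where "W = (\<Sum>i<n. norm (a i) powr r)"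
    have W: "0 \<le> W" by (simp add: W_def sum_nonneg)
    have "(norm (a i))\<^sup>2 = (norm (a i) powr r) powr (2 / r)" for i
      using \<open>2 < r\<close> by (simp add: powr_powr)
    then have "(\<Sum>i<n. (norm (a i))\<^sup>2) \<le> real n * (W / real n) powr (2 / r)"
      unfolding W_def using sum_powr_le_card_powr[of "2 / r" n "\<lambda>i. norm (a i) powr r"] \<open>2 < r\<close> assms by simp
    then have "real n powr (2 / r - 1) * (\<Sum>i<n. (norm (a i))\<^sup>2) \<le>
        real n powr (2 / r - 1) * (real n * (W / real n) powr (2 / r))"
      by (intro mult_left_mono) auto
    also have "\<dots> = W powr (2 / r)"
      using W assms by (simp add: powr_divide powr_diff)
    also have "\<dots> = (lp_norm p n a)\<^sup>2"
      using 2 by (simp add: lp_norm_def W_def power2_eq_square powr_add[symmetric])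
    finally show ?thesis using 2 by simp
  qed
qed

subsection \<open>Euclidean steps in almost transitive subspaces\<close>

definition sq_sum :: "nat \<Rightarrow> (nat \<Rightarrow> 'k::real_normed_field) \<Rightarrow> real" where
  "sq_sum n a = (\<Sum>i<n. (norm (a i))\<^sup>2)"

text \<open>In the applications \<open>m\<close> is the cutoff of the game: each basis coordinate
  that has to vanish may cost one position of modulus 1.\<close>

definition flat :: "nat \<Rightarrow> nat \<Rightarrow> (nat \<Rightarrow> 'k::real_normed_field) \<Rightarrow> bool" where
  "flat n m z \<longleftrightarrow> (\<forall>i<n. norm (z i) \<le> 1) \<and> card {i. i < n \<and> norm (z i) \<noteq> 1} \<le> m"

lemma sq_sum_nonneg: "0 \<le> sq_sum n a"
  by (simp add: sq_sum_def sum_nonneg)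

lemma sq_sum_scale: "sq_sum n (\<lambda>i. c * a i) = (norm c)\<^sup>2 * sq_sum n a"
  by (simp add: sq_sum_def norm_mult power_mult_distrib sum_distrib_left)

lemma flat_uminus: "flat n m z \<Longrightarrow> flat n m (\<lambda>i. - z i)"
  by (simp add: flat_def)

lemma sq_sum_flat_le: "flat n m z \<Longrightarrow> sq_sum n z \<le> real n"
  using sum_mono[of "{..<n}" "\<lambda>i. (norm (z i))\<^sup>2" "\<lambda>_. 1"]
  by (auto simp: flat_def sq_sum_def power_le_one)

lemma sq_sum_flat_ge: "flat n m z \<Longrightarrow> 2 * m \<le> n \<Longrightarrow> real n / 2 \<le> sq_sum n z"
  using sum_indicator_flat_ge[of m n "\<lambda>i. norm (z i)" "\<lambda>x. x\<^sup>2"] by (simp add: flat_def sq_sum_def)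

text \<open>\<open>inner\<close> is the real inner product of the scalar field, also for complex
  scalars. The cross term is therefore real and odd in \<open>z\<close>, so that a change of sign
  decides its direction.\<close>

lemma sq_sum_add:
  fixes a z :: "nat \<Rightarrow> 'k::{real_normed_field, euclidean_space}"
  shows "sq_sum n (\<lambda>i. of_real r * a i + of_real t * z i) =
    r\<^sup>2 * sq_sum n a + t\<^sup>2 * sq_sum n z + 2 * r * t * (\<Sum>i<n. inner (a i) (z i))"
proof -
  have "(norm (of_real r * x + of_real t * y))\<^sup>2 = r\<^sup>2 * (norm x)\<^sup>2 + t\<^sup>2 * (norm y)\<^sup>2 + 2 * r * t * inner x y"
    for x y :: 'k
  proof -
    have "of_real r * x + of_real t * y = r *\<^sub>R x + t *\<^sub>R y"
      by (simp add: scaleR_conv_of_real)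
    then show ?thesis
      unfolding power2_norm_eq_inner
      by (simp add: inner_add inner_commute[of y x] power2_eq_square distrib_left)
  qed
  then show ?thesis
    by (simp add: sq_sum_def sum.distrib sum_distrib_left)
qed

text \<open>Uniform continuity of squaring on bounded sets. \<open>\<theta>\<close> must not depend
  on \<open>X\<close>, because it is fixed before the vector whose norm is \<open>X\<close> is
  known.\<close>

lemma ex_square_perturbation:
  fixes G \<delta> :: real
  assumes "0 \<le> G" "0 < \<delta>"
  obtains \<theta> where "0 < \<theta>" "\<And>X. 0 \<le> X \<Longrightarrow> X\<^sup>2 \<le> G \<Longrightarrow> (X + \<theta>)\<^sup>2 \<le> G + \<delta>"
proof -
  define \<theta> where "\<theta> = min 1 (\<delta> / (2 * G + 3))"
  have \<theta>: "0 < \<theta>" "\<theta> \<le> 1" using assms by (auto simp: \<theta>_def)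
  have "\<theta> \<le> \<delta> / (2 * G + 3)" by (simp add: \<theta>_def)
  then have le: "\<theta> * (2 * G + 3) \<le> \<delta>" using assms by (simp add: field_simps)
  have "(X + \<theta>)\<^sup>2 \<le> G + \<delta>" if "0 \<le> X" "X\<^sup>2 \<le> G" for X
  proof -
    have "X\<^sup>2 \<le> (G + 1)\<^sup>2"
      using that assms zero_le_power2[of G] unfolding power2_sum power_one mult_1_right by linarith
    then have "X \<le> G + 1" by (rule power2_le_imp_le) (use assms in simp)
    have "(X + \<theta>)\<^sup>2 = X\<^sup>2 + \<theta> * (2 * X + \<theta>)" by (simp add: power2_eq_square algebra_simps)
    also have "\<theta> * (2 * X + \<theta>) \<le> \<theta> * (2 * G + 3)"
      using \<theta> \<open>X \<le> G + 1\<close> by (intro mult_left_mono) auto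
    finally show ?thesis using that le by linarith
  qed
  with \<theta>(1) that show ?thesis by blast
qed

locale almost_transitive_subspace = schauder_space scl e
  for scl :: "'k::{real_normed_field, euclidean_space} \<Rightarrow> 'a::banach \<Rightarrow> 'a" and e +
  fixes Y :: "'a set" and N :: "'a \<Rightarrow> real" and c\<^sub>0 C\<^sub>0 :: real
  assumes subspace_Y: "subspace Y"
    and infinite_dim: "\<not> (\<exists>B. finite B \<and> Y = span B)"
    and norm_N: "is_norm_on scl Y N"
    and c\<^sub>0_pos: "0 < c\<^sub>0" and C\<^sub>0_pos: "0 < C\<^sub>0"
    and N_ge: "y \<in> Y \<Longrightarrow> c\<^sub>0 * norm y \<le> N y"
    and N_le: "y \<in> Y \<Longrightarrow> N y \<le> C\<^sub>0 * norm y"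
    and transitive: "almost_transitive scl Y N"
begin

lemma N_nonneg: "y \<in> Y \<Longrightarrow> 0 \<le> N y"
  and N_eq_0: "y \<in> Y \<Longrightarrow> N y = 0 \<longleftrightarrow> y = 0"
  and N_scl: "y \<in> Y \<Longrightarrow> N (scl c y) = norm c * N y"
  and N_add: "x \<in> Y \<Longrightarrow> y \<in> Y \<Longrightarrow> N (x + y) \<le> N x + N y"
  using norm_N by (simp_all add: is_norm_on_def)

lemma N_0: "N 0 = 0"
  using N_eq_0[of 0] subspace_0[OF subspace_Y] by simp

lemma N_scaleR: "y \<in> Y \<Longrightarrow> N (r *\<^sub>R y) = \<bar>r\<bar> * N y"
  using N_scl[of y "of_real r"] by (simp add: scl_of_real)

lemma N_minus_commute: "x \<in> Y \<Longrightarrow> y \<in> Y \<Longrightarrow> N (x - y) = N (y - x)"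
  using N_scaleR[of "y - x" "-1"] by (simp add: subspace_diff[OF subspace_Y])

lemma scaleR_Y: "y \<in> Y \<Longrightarrow> r *\<^sub>R y \<in> Y"
  by (rule subspace_scaleR[OF subspace_Y])

lemma lincomb_Y: "set xs \<subseteq> Y \<Longrightarrow> lincomb xs a \<in> Y"
  unfolding lincomb_def by (intro subspace_sum subspace_scale subspace_Y) auto

lemma isometry_Y: "T \<in> surj_lin_isometries scl Y N \<Longrightarrow> y \<in> Y \<Longrightarrow> T y \<in> Y"
  and isometry_N: "T \<in> surj_lin_isometries scl Y N \<Longrightarrow> y \<in> Y \<Longrightarrow> N (T y) = N y"
  and isometry_add: "T \<in> surj_lin_isometries scl Y N \<Longrightarrow> x \<in> Y \<Longrightarrow> y \<in> Y \<Longrightarrow> T (x + y) = T x + T y"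
  and isometry_scl: "T \<in> surj_lin_isometries scl Y N \<Longrightarrow> y \<in> Y \<Longrightarrow> T (scl c y) = scl c (T y)"
  by (auto simp: surj_lin_isometries_def)

lemma isometry_scaleR: "T \<in> surj_lin_isometries scl Y N \<Longrightarrow> y \<in> Y \<Longrightarrow> T (r *\<^sub>R y) = r *\<^sub>R T y"
  using isometry_scl[of T y "of_real r"] by (simp add: scl_of_real)

lemma isometry_lincomb:
  assumes "T \<in> surj_lin_isometries scl Y N" "set xs \<subseteq> Y"
  shows "T (lincomb xs a) = (\<Sum>i<length xs. scl (a i) (T (xs ! i)))"
proof -
  have "T 0 = 0"
    using isometry_scl[OF assms(1), of 0 0] subspace_0[OF subspace_Y] by simp
  have "T (\<Sum>i\<in>J. scl (a i) (xs ! i)) = (\<Sum>i\<in>J. scl (a i) (T (xs ! i)))" if "J \<subseteq> {..<length xs}" for J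
    using finite_subset[OF that finite_lessThan] that
  proof (induction J)
    case (insert j J)
    have "xs ! i \<in> Y" if "i \<in> insert j J" for i
      using insert.prems that assms(2) by (auto simp: subset_iff)
    then show ?case
      using insert by (simp add: isometry_add[OF assms(1)] isometry_scl[OF assms(1)]
          subspace_scale[OF subspace_Y] subspace_sum[OF subspace_Y])
  qed (simp add: \<open>T 0 = 0\<close>)
  then show ?thesis by (simp add: lincomb_def)
qed

text \<open>Among \<open>m + 1\<close> independent vectors of \<open>Y\<close> some nontrivial
  combination satisfies the \<open>m\<close> equations for the first coordinates.\<close>

lemma ex_unit_beyond: "\<exists>x\<in>Y. norm x = 1 \<and> beyond scl e m x"
proof -
  obtain B where B: "B \<subseteq> Y" "independent B" "Y \<subseteq> span B"
    by (rule maximal_independent_subset)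
  have "span B \<subseteq> Y" using B(1) subspace_Y by (rule span_minimal)
  then have "infinite B" using infinite_dim B by blast
  then obtain S where S: "finite S" "card S = Suc m" "S \<subseteq> B"
    by (metis infinite_arbitrarily_large)
  obtain w where w: "\<exists>v\<in>S. w v \<noteq> 0" "\<And>j. j < m \<Longrightarrow> (\<Sum>v\<in>S. w v * coord v j) = 0"
    using ex_kernel_vector[OF S(1), of m "\<lambda>j v. coord v j"] S(2) by auto
  define x where "x = (\<Sum>v\<in>S. scl (w v) v)"
  have "x \<in> Y"
    unfolding x_def using S(3) B(1) by (intro subspace_sum subspace_scale subspace_Y) auto
  have "x \<noteq> 0"
    using independent_mono[OF B(2) S(3)] w(1) dependent_finite[OF S(1)] by (auto simp: x_def)
  have "beyond scl e m x"
    using w(2) by (simp add: beyond_iff x_def coord_sum coord_scl)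
  then have "beyond scl e m ((1 / norm x) *\<^sub>R x)"
    using beyond_scl[of m x "of_real (1 / norm x)"] by (simp only: scl_of_real)
  moreover have "norm ((1 / norm x) *\<^sub>R x) = 1" using \<open>x \<noteq> 0\<close> by simp
  ultimately show ?thesis using scaleR_Y[OF \<open>x \<in> Y\<close>] by blast
qed

text \<open>For fixed \<open>T\<close> the support condition is a system of \<open>m\<close> linear
  equations in \<open>z\<close>. Flatness and these equations survive the passage to
  \<open>- z\<close>, which settles the sign.\<close>

lemma ex_flat_beyond:
  assumes "T \<in> surj_lin_isometries scl Y N" "set xs \<subseteq> Y"
  shows "\<exists>z. flat (length xs) m z \<and> beyond scl e m (T (lincomb xs z)) \<and> 0 \<le> (\<Sum>i<length xs. inner (a i) (z i))"
proof -
  obtain z where z: "flat (length xs) m z" "\<And>j. j < m \<Longrightarrow> (\<Sum>i<length xs. z i * coord (T (xs ! i)) j) = 0"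
    using ex_flat_kernel_vector[of "length xs" m "\<lambda>j i. coord (T (xs ! i)) j"] by (auto simp: flat_def)
  have beyond: "beyond scl e m (T (lincomb xs (\<lambda>i. c * z i)))" for c
    using z(2) by (simp add: isometry_lincomb[OF assms] beyond_iff coord_sum coord_scl mult.assoc
        sum_distrib_left[symmetric])
  show ?thesis
  proof (cases "0 \<le> (\<Sum>i<length xs. inner (a i) (z i))")
    case True
    with z(1) beyond[of 1] show ?thesis by auto
  next
    case False
    with flat_uminus[OF z(1)] beyond[of "-1"] show ?thesis
      by (intro exI[of _ "\<lambda>i. - z i"]) (auto simp: sum_negf)
  qed
qed

text \<open>Almost transitivity moves the vector \<open>lincomb xs a\<close>, at which a Euclidean norm on
  the span of \<open>xs\<close> touches \<open>N\<close>, close to the given direction \<open>s\<close>.\<close>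

lemma ex_moved_flat:
  assumes "set xs \<subseteq> Y" "N (lincomb xs a) = 1" "s \<in> Y" "s \<noteq> 0" "0 < \<theta>"
    and "\<And>z. flat (length xs) m z \<Longrightarrow> 0 < N (lincomb xs z)"
  obtains z \<tau> x where "flat (length xs) m z" "0 \<le> (\<Sum>i<length xs. inner (b i) (z i))"
    "x \<in> Y" "norm x = 1" "beyond scl e m x"
    "c\<^sub>0 / N (lincomb xs z) \<le> \<tau>" "\<tau> \<le> C\<^sub>0 / N (lincomb xs z)"
    "\<bar>N (s + x) - N (lincomb xs (\<lambda>i. of_real (N s) * a i + of_real \<tau> * z i))\<bar> \<le> \<theta>"
proof -
  have r: "0 < N s" using assms N_nonneg N_eq_0 by (metis order_le_less)
  define y where "y = lincomb xs a"
  have y: "y \<in> Y" "N y = 1" using lincomb_Y[OF assms(1)] assms(2) by (auto simp: y_def)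
  have s1: "(1 / N s) *\<^sub>R s \<in> Y" "N ((1 / N s) *\<^sub>R s) = 1"
    using scaleR_Y assms(3) N_scaleR r by auto
  \<comment> \<open>The tolerance is divided by \<open>N s\<close> because the error is multiplied
    by \<open>N s\<close> when the unit vectors are scaled back. \<open>T\<close> has to precede
    \<open>z\<close>, whose equations involve it.\<close>
  obtain T where T: "T \<in> surj_lin_isometries scl Y N" "N (T y - (1 / N s) *\<^sub>R s) < \<theta> / N s"
    using transitive y s1 r \<open>0 < \<theta>\<close> unfolding almost_transitive_def
    by (metis divide_pos_pos)
  obtain z where z: "flat (length xs) m z" "beyond scl e m (T (lincomb xs z))"
    "0 \<le> (\<Sum>i<length xs. inner (b i) (z i))"
    using ex_flat_beyond[OF T(1) assms(1)] by blast
  define u where "u = lincomb xs z"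
  have u: "u \<in> Y" "0 < N u" using lincomb_Y[OF assms(1)] assms(6)[OF z(1)] by (auto simp: u_def)
  define w where "w = T u"
  have w: "w \<in> Y" "N w = N u" using isometry_Y[OF T(1)] isometry_N[OF T(1)] u by (auto simp: w_def)
  have "0 < norm w" using u(2) w N_eq_0 by fastforce
  \<comment> \<open>The vectors played are normalized in the original norm. As \<open>T\<close>
    preserves \<open>N\<close>, equivalence of the norms pins \<open>\<tau>\<close> between
    \<open>c\<^sub>0 / N u\<close> and \<open>C\<^sub>0 / N u\<close>.\<close>
  define \<tau> where "\<tau> = 1 / norm w"
  have \<tau>: "0 < \<tau>" using \<open>0 < norm w\<close> by (simp add: \<tau>_def)
  define x where "x = \<tau> *\<^sub>R w"
  have x: "x \<in> Y" "norm x = 1"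
    using scaleR_Y[OF w(1)] \<open>0 < norm w\<close> by (auto simp: x_def \<tau>_def)
  have bx: "beyond scl e m x"
    using beyond_scl[OF z(2), of "of_real \<tau>"] by (simp only: scl_of_real x_def w_def u_def)
  have "c\<^sub>0 / N u \<le> \<tau>" "\<tau> \<le> C\<^sub>0 / N u"
    using N_ge[OF w(1)] N_le[OF w(1)] w(2) u(2) \<open>0 < norm w\<close> by (auto simp: \<tau>_def field_simps)
  define v where "v = lincomb xs (\<lambda>i. of_real (N s) * a i + of_real \<tau> * z i)"
  have v_eq: "v = N s *\<^sub>R y + \<tau> *\<^sub>R u"
    by (simp add: v_def y_def u_def lincomb_add lincomb_scl scl_of_real)
  have v: "v \<in> Y" "T v \<in> Y" using lincomb_Y[OF assms(1)] isometry_Y[OF T(1)] by (auto simp: v_def)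
  have sx: "s + x \<in> Y" using assms(3) x by (intro subspace_add subspace_Y)
  have "T v = N s *\<^sub>R T y + x"
    using isometry_add[OF T(1)] isometry_scaleR[OF T(1)] y u scaleR_Y by (simp add: v_eq x_def w_def)
  then have "T v - (s + x) = N s *\<^sub>R (T y - (1 / N s) *\<^sub>R s)"
    using r by (simp add: algebra_simps)
  moreover have "T y - (1 / N s) *\<^sub>R s \<in> Y"
    using isometry_Y[OF T(1) y(1)] s1 by (intro subspace_diff subspace_Y)
  ultimately have "N (T v - (s + x)) = N s * N (T y - (1 / N s) *\<^sub>R s)"
    using r by (simp only: N_scaleR abs_of_pos)
  then have "N (T v - (s + x)) \<le> \<theta>"
    using T(2) r by (simp add: field_simps)
  moreover have "N (s + x) \<le> N (T v) + N (T v - (s + x))"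
    using N_add[OF v(2), of "s + x - T v"] N_minus_commute[OF v(2) sx] v sx
    by (simp add: subspace_diff[OF subspace_Y])
  moreover have "N (T v) \<le> N (s + x) + N (T v - (s + x))"
    using N_add[OF sx, of "T v - (s + x)"] v sx by (simp add: subspace_diff[OF subspace_Y])
  ultimately have "\<bar>N (s + x) - N v\<bar> \<le> \<theta>"
    using isometry_N[OF T(1) v(1)] by linarith
  with z x bx \<open>c\<^sub>0 / N u \<le> \<tau>\<close> \<open>\<tau> \<le> C\<^sub>0 / N u\<close> that show ?thesis
    unfolding u_def v_def by blast
qed

text \<open>The bound \<open>B\<close> in \<open>model\<close> is the same for all \<open>m\<close>.
  A multiple \<open>\<kappa> \<le> \<rho>\<close> of \<open>sq_sum\<close> agrees with the square of
  \<open>N\<close> at \<open>a\<close> and dominates it up to \<open>1 + \<eta>\<close>. With a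
  nonpositive cross term, the increment is at most about
  \<open>\<kappa> * \<tau>\<^sup>2 * sq_sum n z\<close>, where \<open>n = length xs\<close>, and
  flatness together with \<open>\<tau> \<le> C\<^sub>0 / N (lincomb xs z)\<close> bounds this by
  \<open>B * C\<^sub>0\<^sup>2\<close>.\<close>

lemma ex_upper_step:
  assumes "0 < B" and model: "\<And>m. \<exists>xs \<rho>. 2 * m \<le> length xs \<and> xs \<noteq> [] \<and> set xs \<subseteq> Y \<and> 0 < \<rho> \<and>
      (\<forall>a. (N (lincomb xs a))\<^sup>2 \<le> \<rho> * sq_sum (length xs) a) \<and>
      (\<forall>z. flat (length xs) m z \<longrightarrow> \<rho> * real (length xs) \<le> B * (N (lincomb xs z))\<^sup>2)"
    and "s \<in> Y"
  shows "\<exists>x\<in>Y. norm x = 1 \<and> beyond scl e m x \<and> (N (s + x))\<^sup>2 \<le> (N s)\<^sup>2 + (B + 1) * C\<^sub>0\<^sup>2 + 1"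
proof (cases "s = 0")
  case True
  obtain x where x: "x \<in> Y" "norm x = 1" "beyond scl e m x" using ex_unit_beyond by blast
  have "(N x)\<^sup>2 \<le> C\<^sub>0\<^sup>2" using N_le[OF x(1)] N_nonneg[OF x(1)] x(2) by (intro power_mono) auto
  also have "\<dots> \<le> (B + 1) * C\<^sub>0\<^sup>2 + 1" using \<open>0 < B\<close> by (simp add: algebra_simps)
  finally show ?thesis using True x by (intro bexI[of _ x]) (auto simp: N_0)
next
  case False
  obtain xs \<rho> where xs: "2 * m \<le> length xs" "xs \<noteq> []" "set xs \<subseteq> Y" and "0 < \<rho>"
    and upper: "\<And>a. (N (lincomb xs a))\<^sup>2 \<le> \<rho> * sq_sum (length xs) a"
    and flat_ge: "\<And>z. flat (length xs) m z \<Longrightarrow> \<rho> * real (length xs) \<le> B * (N (lincomb xs z))\<^sup>2"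
    using model[of m] by blast
  let ?n = "length xs"
  have N0: "0 \<le> N (lincomb xs a)" for a using N_nonneg[OF lincomb_Y[OF xs(3)]] .
  have pos: "0 < N (lincomb xs z)" if "flat ?n m z" for z
  proof -
    have "0 < \<rho> * real ?n" using \<open>0 < \<rho>\<close> xs(2) by simp
    also have "\<dots> \<le> B * (N (lincomb xs z))\<^sup>2" by (rule flat_ge[OF that])
    finally have "N (lincomb xs z) \<noteq> 0" by auto
    then show ?thesis using N0[of z] by simp
  qed
  have sq_pos: "0 < sq_sum ?n a" if "0 < N (lincomb xs a)" for a
    using upper[of a] that \<open>0 < \<rho>\<close> by (smt (verit) mult_nonneg_nonpos zero_less_power)
  define G where "G = (N s)\<^sup>2 + B * C\<^sub>0\<^sup>2"
  have "0 < G" using C\<^sub>0_pos \<open>0 < B\<close> by (simp add: G_def add_nonneg_pos)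
  \<comment> \<open>The additive 1 in the conclusion is split: 1/2 pays for almost maximality
    through \<open>\<eta>\<close>, 1/2 for the approximation error \<open>\<theta>\<close>.\<close>
  define \<eta> where "\<eta> = 1 / (2 * G)"
  have \<eta>: "0 < \<eta>" "(1 + \<eta>) * G = G + 1/2" using \<open>0 < G\<close> by (simp_all add: \<eta>_def field_simps)
  have "flat ?n m (\<lambda>_. 1)" by (simp add: flat_def)
  then have "\<exists>a\<in>{a. 0 < N (lincomb xs a)}. \<forall>x\<in>{a. 0 < N (lincomb xs a)}.
      (N (lincomb xs x))\<^sup>2 / sq_sum ?n x \<le> (1 + \<eta>) * ((N (lincomb xs a))\<^sup>2 / sq_sum ?n a)"
    using pos sq_pos upper \<eta>(1)
    by (intro ex_almost_maximizer[where x = "\<lambda>_. 1" and B = \<rho>]) (auto simp: divide_le_eq)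
  then obtain a\<^sub>1 where a\<^sub>1: "0 < N (lincomb xs a\<^sub>1)" "\<And>x. 0 < N (lincomb xs x) \<Longrightarrow>
      (N (lincomb xs x))\<^sup>2 / sq_sum ?n x \<le> (1 + \<eta>) * ((N (lincomb xs a\<^sub>1))\<^sup>2 / sq_sum ?n a\<^sub>1)"
    by blast
  define \<kappa> where "\<kappa> = (N (lincomb xs a\<^sub>1))\<^sup>2 / sq_sum ?n a\<^sub>1"
  have \<kappa>: "0 < \<kappa>" "\<kappa> \<le> \<rho>"
    using a\<^sub>1(1) sq_pos upper[of a\<^sub>1] by (auto simp: \<kappa>_def divide_le_eq)
  have almost: "(N (lincomb xs x))\<^sup>2 \<le> (1 + \<eta>) * \<kappa> * sq_sum ?n x" for x
  proof (cases "0 < N (lincomb xs x)")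
    case True
    then show ?thesis using a\<^sub>1(2)[OF True] sq_pos[OF True] by (simp add: \<kappa>_def[symmetric] divide_le_eq)
  next
    case False
    then have "N (lincomb xs x) = 0" using N0[of x] by simp
    then show ?thesis using \<kappa> \<eta> sq_sum_nonneg[of ?n x] by simp
  qed
  define a where "a = (\<lambda>i. of_real (1 / N (lincomb xs a\<^sub>1)) * a\<^sub>1 i)"
  have a: "N (lincomb xs a) = 1"
    using a\<^sub>1(1) N_scaleR[OF lincomb_Y[OF xs(3)]] unfolding a_def lincomb_scl scl_of_real by simp
  have sq_a: "\<kappa> * sq_sum ?n a = 1"
    using a\<^sub>1(1) sq_pos[OF a\<^sub>1(1)] unfolding a_def sq_sum_scale by (simp add: \<kappa>_def norm_divide power_divide)
  obtain \<theta> where \<theta>: "0 < \<theta>" "\<And>X. 0 \<le> X \<Longrightarrow> X\<^sup>2 \<le> G + 1/2 \<Longrightarrow> (X + \<theta>)\<^sup>2 \<le> G + 1/2 + 1/2"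
    using ex_square_perturbation[of "G + 1/2" "1/2"] \<open>0 < G\<close> by auto
  \<comment> \<open>The sign condition is imposed with \<open>- a\<close>, so the cross term is
    nonpositive.\<close>
  obtain z \<tau> x where z: "flat ?n m z" "0 \<le> (\<Sum>i<?n. inner (- a i) (z i))"
    and x: "x \<in> Y" "norm x = 1" "beyond scl e m x"
    and \<tau>: "c\<^sub>0 / N (lincomb xs z) \<le> \<tau>" "\<tau> \<le> C\<^sub>0 / N (lincomb xs z)"
    and close: "\<bar>N (s + x) - N (lincomb xs (\<lambda>i. of_real (N s) * a i + of_real \<tau> * z i))\<bar> \<le> \<theta>"
    by (rule ex_moved_flat[OF xs(3) a \<open>s \<in> Y\<close> False \<theta>(1) pos, where b = "\<lambda>i. - a i" and m = m])
  define X where "X = N (lincomb xs (\<lambda>i. of_real (N s) * a i + of_real \<tau> * z i))"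
  have "0 \<le> X" by (simp add: X_def N0)
  have "0 < \<tau>" using \<tau>(1) c\<^sub>0_pos pos[OF z(1)] by (meson divide_pos_pos less_le_trans)
  have "\<kappa> * (\<tau>\<^sup>2 * sq_sum ?n z) \<le> \<rho> * (\<tau>\<^sup>2 * real ?n)"
    using \<kappa> sq_sum_flat_le[OF z(1)] sq_sum_nonneg by (intro mult_mono mult_nonneg_nonneg) auto
  also have "\<dots> = \<tau>\<^sup>2 * (\<rho> * real ?n)" by simp
  also have "\<dots> \<le> (C\<^sub>0 / N (lincomb xs z))\<^sup>2 * (B * (N (lincomb xs z))\<^sup>2)"
    using \<open>0 < \<tau>\<close> \<open>0 < \<rho>\<close> by (intro mult_mono[OF power_mono[OF \<tau>(2)] flat_ge[OF z(1)]]) auto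
  also have "\<dots> = B * C\<^sub>0\<^sup>2"
    using pos[OF z(1)] by (simp add: power_divide)
  finally have z_le: "\<kappa> * (\<tau>\<^sup>2 * sq_sum ?n z) \<le> B * C\<^sub>0\<^sup>2" .
  have "X\<^sup>2 \<le> (1 + \<eta>) * \<kappa> * sq_sum ?n (\<lambda>i. of_real (N s) * a i + of_real \<tau> * z i)"
    unfolding X_def by (rule almost)
  also have "\<dots> \<le> (1 + \<eta>) * \<kappa> * ((N s)\<^sup>2 * sq_sum ?n a + \<tau>\<^sup>2 * sq_sum ?n z)"
    unfolding sq_sum_add using z(2) \<kappa> \<eta> \<open>0 < \<tau>\<close> N_nonneg[OF \<open>s \<in> Y\<close>]
    by (intro mult_left_mono) (auto simp: sum_negf intro!: mult_nonneg_nonpos)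
  also have "\<dots> = (1 + \<eta>) * ((N s)\<^sup>2 * (\<kappa> * sq_sum ?n a) + \<kappa> * (\<tau>\<^sup>2 * sq_sum ?n z))"
    by (simp add: algebra_simps)
  also have "\<dots> \<le> (1 + \<eta>) * G"
    unfolding sq_a G_def using z_le \<eta> by (intro mult_left_mono) auto
  finally have "X\<^sup>2 \<le> G + 1/2" using \<eta>(2) by simp
  then have "(X + \<theta>)\<^sup>2 \<le> G + 1" using \<theta>(2)[OF \<open>0 \<le> X\<close>] by simp
  moreover have "(N (s + x))\<^sup>2 \<le> (X + \<theta>)\<^sup>2"
    using close N_nonneg[of "s + x"] subspace_add[OF subspace_Y \<open>s \<in> Y\<close> x(1)]
    unfolding X_def by (intro power_mono) auto
  ultimately have "(N (s + x))\<^sup>2 \<le> (N s)\<^sup>2 + (B + 1) * C\<^sub>0\<^sup>2 + 1"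
    using zero_le_power2[of C\<^sub>0] unfolding G_def distrib_right by linarith
  with x show ?thesis by blast
qed

text \<open>Mirror image of the upper step: the Euclidean norm is dominated by \<open>N\<close>, the
  quotient to be maximized is inverted and the cross term is nonnegative. The first entry of the
  minimum accounts for the start \<open>s = 0\<close>.\<close>

lemma ex_lower_step:
  assumes "0 < B" and model: "\<And>m. \<exists>xs \<rho>. 2 * m \<le> length xs \<and> xs \<noteq> [] \<and> set xs \<subseteq> Y \<and> 0 < \<rho> \<and>
      (\<forall>a. \<rho> * sq_sum (length xs) a \<le> (N (lincomb xs a))\<^sup>2) \<and>
      (\<forall>z. flat (length xs) m z \<longrightarrow> (N (lincomb xs z))\<^sup>2 \<le> B * (\<rho> * real (length xs)))"
    and "s \<in> Y"
  shows "\<exists>x\<in>Y. norm x = 1 \<and> beyond scl e m x \<and> (N s)\<^sup>2 + min (c\<^sub>0\<^sup>2) (c\<^sub>0\<^sup>2 / (4 * B)) \<le> (N (s + x))\<^sup>2"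
proof (cases "s = 0")
  case True
  obtain x where x: "x \<in> Y" "norm x = 1" "beyond scl e m x" using ex_unit_beyond by blast
  have "c\<^sub>0\<^sup>2 \<le> (N x)\<^sup>2" using N_ge[OF x(1)] c\<^sub>0_pos x(2) by (intro power_mono) auto
  then show ?thesis using True x by (intro bexI[of _ x]) (auto simp: N_0)
next
  case False
  obtain xs \<rho> where xs: "2 * m \<le> length xs" "xs \<noteq> []" "set xs \<subseteq> Y" and "0 < \<rho>"
    and lower: "\<And>a. \<rho> * sq_sum (length xs) a \<le> (N (lincomb xs a))\<^sup>2"
    and flat_le: "\<And>z. flat (length xs) m z \<Longrightarrow> (N (lincomb xs z))\<^sup>2 \<le> B * (\<rho> * real (length xs))"
    using model[of m] by blast
  let ?n = "length xs"
  have N0: "0 \<le> N (lincomb xs a)" for a using N_nonneg[OF lincomb_Y[OF xs(3)]] .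
  have N_pos: "0 < N (lincomb xs a)" if "0 < sq_sum ?n a" for a
  proof -
    have "0 < \<rho> * sq_sum ?n a" using \<open>0 < \<rho>\<close> that by simp
    also have "\<dots> \<le> (N (lincomb xs a))\<^sup>2" by (rule lower)
    finally have "N (lincomb xs a) \<noteq> 0" by auto
    then show ?thesis using N0[of a] by simp
  qed
  then have N_nz: "N (lincomb xs a) \<noteq> 0" if "0 < sq_sum ?n a" for a
    using that by force
  have flat_pos: "0 < sq_sum ?n z" if "flat ?n m z" for z
  proof -
    have "0 < real ?n / 2" using xs(2) by simp
    also have "\<dots> \<le> sq_sum ?n z" using sq_sum_flat_ge[OF that xs(1)] .
    finally show ?thesis .
  qed
  \<comment> \<open>Lower bound for \<open>\<kappa> * \<tau>\<^sup>2 * sq_sum ?n z\<close>: here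
    \<open>\<kappa> \<ge> \<rho>\<close>, \<open>\<tau>\<^sup>2\<close> is at least
    \<open>c\<^sub>0\<^sup>2 / (B * \<rho> * ?n)\<close>, and flatness contributes
    \<open>?n / 2\<close>.\<close>
  define \<beta> where "\<beta> = c\<^sub>0\<^sup>2 / (2 * B)"
  have "0 < \<beta>" using c\<^sub>0_pos \<open>0 < B\<close> by (simp add: \<beta>_def)
  define G where "G = (N s)\<^sup>2 + \<beta>"
  have "0 < G" using \<open>0 < \<beta>\<close> by (simp add: G_def add_nonneg_pos)
  \<comment> \<open>A quarter of the gain \<open>\<beta>\<close> is given up for almost extremality
    and a quarter for \<open>\<theta>\<close>; the remaining half is
    \<open>c\<^sub>0\<^sup>2 / (4 * B)\<close>.\<close>
  define \<eta> where "\<eta> = \<beta> / (4 * G)"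
  have "0 < \<eta>" using \<open>0 < G\<close> \<open>0 < \<beta>\<close> by (simp add: \<eta>_def)
  have "flat ?n m (\<lambda>_. 1)" by (simp add: flat_def)
  then have "\<exists>a\<in>{a. 0 < sq_sum ?n a}. \<forall>x\<in>{a. 0 < sq_sum ?n a}.
      sq_sum ?n x / (N (lincomb xs x))\<^sup>2 \<le> (1 + \<eta>) * (sq_sum ?n a / (N (lincomb xs a))\<^sup>2)"
    using flat_pos N_nz lower \<open>0 < \<eta>\<close> \<open>0 < \<rho>\<close>
    by (intro ex_almost_maximizer[where x = "\<lambda>_. 1" and B = "1 / \<rho>"])
      (auto simp: divide_le_eq le_divide_eq mult.commute intro!: divide_pos_pos)
  then obtain a\<^sub>1 where a\<^sub>1: "0 < sq_sum ?n a\<^sub>1" "\<And>x. 0 < sq_sum ?n x \<Longrightarrow>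
      sq_sum ?n x / (N (lincomb xs x))\<^sup>2 \<le> (1 + \<eta>) * (sq_sum ?n a\<^sub>1 / (N (lincomb xs a\<^sub>1))\<^sup>2)"
    by blast
  define \<kappa> where "\<kappa> = (N (lincomb xs a\<^sub>1))\<^sup>2 / sq_sum ?n a\<^sub>1"
  have \<kappa>: "0 < \<kappa>" "\<rho> \<le> \<kappa>"
    using a\<^sub>1(1) N_pos[OF a\<^sub>1(1)] lower[of a\<^sub>1] by (auto simp: \<kappa>_def le_divide_eq)
  have almost: "\<kappa> * sq_sum ?n x \<le> (1 + \<eta>) * (N (lincomb xs x))\<^sup>2" for x
  proof (cases "0 < sq_sum ?n x")
    case True
    have "sq_sum ?n x / (N (lincomb xs x))\<^sup>2 \<le> (1 + \<eta>) * (1 / \<kappa>)"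
      using a\<^sub>1(2)[OF True] by (simp add: \<kappa>_def)
    then show ?thesis using N_pos[OF True] \<kappa>(1) by (simp add: field_simps)
  next
    case False
    then have "sq_sum ?n x = 0" using sq_sum_nonneg[of ?n x] by simp
    then show ?thesis using \<open>0 < \<eta>\<close> by simp
  qed
  define a where "a = (\<lambda>i. of_real (1 / N (lincomb xs a\<^sub>1)) * a\<^sub>1 i)"
  have a: "N (lincomb xs a) = 1"
    using N_pos[OF a\<^sub>1(1)] N_scaleR[OF lincomb_Y[OF xs(3)]] unfolding a_def lincomb_scl scl_of_real by simp
  have sq_a: "\<kappa> * sq_sum ?n a = 1"
    using a\<^sub>1(1) N_pos[OF a\<^sub>1(1)] unfolding a_def sq_sum_scale by (simp add: \<kappa>_def norm_divide power_divide)
  define Z where "Z = sqrt ((N s)\<^sup>2 + \<beta> / 2)"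
  have Z: "0 \<le> Z" "Z\<^sup>2 = (N s)\<^sup>2 + \<beta> / 2" using \<open>0 < \<beta>\<close> by (simp_all add: Z_def)
  obtain \<theta> where \<theta>: "0 < \<theta>" "(Z + \<theta>)\<^sup>2 \<le> (N s)\<^sup>2 + \<beta> / 2 + \<beta> / 4"
    using ex_square_perturbation[of "(N s)\<^sup>2 + \<beta> / 2" "\<beta> / 4"] \<open>0 < \<beta>\<close> Z
    by (metis add_nonneg_nonneg divide_pos_pos half_gt_zero less_imp_le order_refl zero_le_power2 zero_less_numeral)
  obtain z \<tau> x where z: "flat ?n m z" "0 \<le> (\<Sum>i<?n. inner (a i) (z i))"
    and x: "x \<in> Y" "norm x = 1" "beyond scl e m x"
    and \<tau>: "c\<^sub>0 / N (lincomb xs z) \<le> \<tau>" "\<tau> \<le> C\<^sub>0 / N (lincomb xs z)"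
    and close: "\<bar>N (s + x) - N (lincomb xs (\<lambda>i. of_real (N s) * a i + of_real \<tau> * z i))\<bar> \<le> \<theta>"
    by (rule ex_moved_flat[OF xs(3) a \<open>s \<in> Y\<close> False \<theta>(1) N_pos[OF flat_pos], where b = a and m = m])
  define X where "X = N (lincomb xs (\<lambda>i. of_real (N s) * a i + of_real \<tau> * z i))"
  have "0 \<le> X" by (simp add: X_def N0)
  have Nz: "0 < N (lincomb xs z)" using N_pos[OF flat_pos[OF z(1)]] .
  then have "0 < \<tau>" using \<tau>(1) c\<^sub>0_pos by (meson divide_pos_pos less_le_trans)
  have "\<beta> = (c\<^sub>0 / N (lincomb xs z))\<^sup>2 * ((N (lincomb xs z))\<^sup>2 / (2 * B))"
    using Nz by (simp add: \<beta>_def power_divide)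
  also have "\<dots> \<le> \<tau>\<^sup>2 * (B * (\<rho> * real ?n) / (2 * B))"
    using \<tau>(1) c\<^sub>0_pos Nz flat_le[OF z(1)] \<open>0 < B\<close>
    by (intro mult_mono power_mono divide_right_mono) auto
  also have "\<dots> = \<rho> * (\<tau>\<^sup>2 * (real ?n / 2))" using \<open>0 < B\<close> by simp
  also have "\<dots> \<le> \<kappa> * (\<tau>\<^sup>2 * sq_sum ?n z)"
    using \<kappa>(1) by (intro mult_mono[OF \<kappa>(2) mult_left_mono[OF sq_sum_flat_ge[OF z(1) xs(1)]]]) auto
  finally have z_ge: "\<beta> \<le> \<kappa> * (\<tau>\<^sup>2 * sq_sum ?n z)" .
  have "G \<le> (N s)\<^sup>2 * (\<kappa> * sq_sum ?n a) + \<kappa> * (\<tau>\<^sup>2 * sq_sum ?n z)"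
    unfolding sq_a G_def using z_ge by simp
  also have "\<dots> = \<kappa> * ((N s)\<^sup>2 * sq_sum ?n a + \<tau>\<^sup>2 * sq_sum ?n z)"
    by (simp add: algebra_simps)
  also have "\<dots> \<le> \<kappa> * sq_sum ?n (\<lambda>i. of_real (N s) * a i + of_real \<tau> * z i)"
    unfolding sq_sum_add using z(2) \<kappa> \<open>0 < \<tau>\<close> N_nonneg[OF \<open>s \<in> Y\<close>]
    by (intro mult_left_mono) auto
  also have "\<dots> \<le> (1 + \<eta>) * X\<^sup>2"
    unfolding X_def by (rule almost)
  finally have G_le: "G \<le> (1 + \<eta>) * X\<^sup>2" .
  have "(1 + \<eta>) * (G - \<beta> / 4) = G - \<beta>\<^sup>2 / (16 * G)"
    using \<open>0 < G\<close> by (simp add: \<eta>_def field_simps power2_eq_square)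
  also have "\<dots> \<le> G" using \<open>0 < G\<close> by simp
  also have "G \<le> (1 + \<eta>) * X\<^sup>2" by (rule G_le)
  finally have "G - \<beta> / 4 \<le> X\<^sup>2" using \<open>0 < \<eta>\<close> by simp
  then have "(Z + \<theta>)\<^sup>2 \<le> X\<^sup>2" using \<theta>(2) by (simp add: G_def)
  then have "Z + \<theta> \<le> X" using \<open>0 \<le> X\<close> by (rule power2_le_imp_le)
  then have "Z \<le> N (s + x)" using close unfolding X_def by linarith
  then have "Z\<^sup>2 \<le> (N (s + x))\<^sup>2" using Z(1) by (rule power_mono)
  then have "(N s)\<^sup>2 + min (c\<^sub>0\<^sup>2) (c\<^sub>0\<^sup>2 / (4 * B)) \<le> (N (s + x))\<^sup>2"
    unfolding Z(2) by (simp add: \<beta>_def min_le_iff_disj)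
  with x show ?thesis by blast
qed

section \<open>Growth of norms along a play against growth of the p-norm\<close>

lemma asymptotic_lp_vectors_in_Y:
  assumes "asymptotic_lp scl e p"
  obtains C where "0 < C"
    "\<And>Q n. Q [] \<Longrightarrow>
      (\<And>ys m. Q ys \<Longrightarrow> set ys \<subseteq> Y \<Longrightarrow> \<exists>x\<in>Y. norm x = 1 \<and> beyond scl e m x \<and> Q (ys @ [x])) \<Longrightarrow> 1 \<le> n \<Longrightarrow>
      \<exists>ys. length ys = n \<and> set ys \<subseteq> Y \<and> Q ys \<and> (\<forall>a. lp_norm p n a \<le> C * N (lincomb ys a) \<and>
        N (lincomb ys a) \<le> C * lp_norm p n a)"
proof -
  obtain C where C: "0 < C"
    "\<And>Q n. Q [] \<Longrightarrow> (\<And>ys m. Q ys \<Longrightarrow> \<exists>x. norm x = 1 \<and> beyond scl e m x \<and> Q (ys @ [x])) \<Longrightarrow> 1 \<le> n \<Longrightarrow>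
      \<exists>ys. length ys = n \<and> Q ys \<and> (\<forall>a. lp_norm p n a \<le> C * norm (lincomb ys a) \<and>
        norm (lincomb ys a) \<le> C * lp_norm p n a)"
    by (rule asymptotic_lp_vectors[OF assms]) blast
  let ?C = "max (C / c\<^sub>0) (C\<^sub>0 * C)"
  show ?thesis
  proof (rule that)
    show "0 < ?C" using C(1) c\<^sub>0_pos by (simp add: less_max_iff_disj)
    fix Q and n :: nat
    assume Q: "Q []" "\<And>ys m. Q ys \<Longrightarrow> set ys \<subseteq> Y \<Longrightarrow> \<exists>x\<in>Y. norm x = 1 \<and> beyond scl e m x \<and> Q (ys @ [x])"
      and n: "1 \<le> n"
    have "\<exists>x. norm x = 1 \<and> beyond scl e m x \<and> set (ys @ [x]) \<subseteq> Y \<and> Q (ys @ [x])"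
      if "set ys \<subseteq> Y \<and> Q ys" for ys m
      using Q(2)[of ys m] that by auto
    then obtain ys where ys: "length ys = n" "set ys \<subseteq> Y" "Q ys"
      and lp: "\<And>a. lp_norm p n a \<le> C * norm (lincomb ys a)" "\<And>a. norm (lincomb ys a) \<le> C * lp_norm p n a"
      using C(2)[of "\<lambda>ys. set ys \<subseteq> Y \<and> Q ys" n] Q(1) n by auto
    have "lp_norm p n a \<le> ?C * N (lincomb ys a) \<and> N (lincomb ys a) \<le> ?C * lp_norm p n a" for a
    proof
      have Y: "lincomb ys a \<in> Y" by (rule lincomb_Y[OF ys(2)])
      have "lp_norm p n a \<le> C * norm (lincomb ys a)" by (rule lp)
      also have "\<dots> \<le> C * (N (lincomb ys a) / c\<^sub>0)"
        using N_ge[OF Y] c\<^sub>0_pos C(1) by (intro mult_left_mono) (auto simp: field_simps)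
      also have "\<dots> = C / c\<^sub>0 * N (lincomb ys a)" by simp
      also have "\<dots> \<le> ?C * N (lincomb ys a)"
        using N_nonneg[OF Y] by (intro mult_right_mono) auto
      finally show "lp_norm p n a \<le> ?C * N (lincomb ys a)" .
      have "N (lincomb ys a) \<le> C\<^sub>0 * (C * lp_norm p n a)"
        using N_le[OF Y] lp(2)[of a] C\<^sub>0_pos by (meson less_imp_le mult_left_mono order_trans)
      also have "\<dots> \<le> ?C * lp_norm p n a"
        using lp_norm_nonneg[OF n, of p a] by (simp add: mult.assoc[symmetric] mult_right_mono)
      finally show "N (lincomb ys a) \<le> ?C * lp_norm p n a" .
    qed
    with ys show "\<exists>ys. length ys = n \<and> set ys \<subseteq> Y \<and> Q ys \<and> (\<forall>a. lp_norm p n a \<le> ?C * N (lincomb ys a) \<and>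
        N (lincomb ys a) \<le> ?C * lp_norm p n a)"
      by blast
  qed
qed

text \<open>\<open>asymptotic_lp_vectors_in_Y\<close> is used twice: the trivial invariant yields
  the models for the upper step, and the invariant maintained by that step yields sums of
  \<open>n\<close> vectors that would bound \<open>real n powr (2 * u - 1)\<close>, whose exponent
  is positive.\<close>

lemma asymptotic_lp_ge_2:
  assumes "asymptotic_lp scl e p" "1 \<le> p"
  shows "2 \<le> p"
proof (rule ccontr)
  assume "\<not> ?thesis"
  then have p: "p < 2" by simp
  obtain C where C: "0 < C"
    "\<And>Q n. Q [] \<Longrightarrow>
      (\<And>ys m. Q ys \<Longrightarrow> set ys \<subseteq> Y \<Longrightarrow> \<exists>x\<in>Y. norm x = 1 \<and> beyond scl e m x \<and> Q (ys @ [x])) \<Longrightarrow> 1 \<le> n \<Longrightarrow>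
      \<exists>ys. length ys = n \<and> set ys \<subseteq> Y \<and> Q ys \<and> (\<forall>a. lp_norm p n a \<le> C * N (lincomb ys a) \<and>
        N (lincomb ys a) \<le> C * lp_norm p n a)"
    by (rule asymptotic_lp_vectors_in_Y[OF assms(1)]) blast
  define u where "u = recip p"
  have u: "1 / 2 < u" unfolding u_def by (rule recip_gt_half[OF assms(2) p])
  have model: "\<exists>xs \<rho>. 2 * m \<le> length xs \<and> xs \<noteq> [] \<and> set xs \<subseteq> Y \<and> 0 < \<rho> \<and>
      (\<forall>a. (N (lincomb xs a))\<^sup>2 \<le> \<rho> * sq_sum (length xs) a) \<and>
      (\<forall>z. flat (length xs) m z \<longrightarrow> \<rho> * real (length xs) \<le> 4 * C ^ 4 * (N (lincomb xs z))\<^sup>2)" for m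
  proof -
    \<comment> \<open>Half of the positions of a flat sequence then have modulus 1, and the list is
      nonempty even for \<open>m = 0\<close>.\<close>
    define n where "n = 2 * m + 1"
    obtain ys where ys: "length ys = n" "set ys \<subseteq> Y"
      and lp: "\<And>a. lp_norm p n a \<le> C * N (lincomb ys a)" "\<And>a. N (lincomb ys a) \<le> C * lp_norm p n a"
      using C(2)[of "\<lambda>_. True" n] ex_unit_beyond by (auto simp: n_def)
    have N0: "0 \<le> N (lincomb ys a)" for a using N_nonneg[OF lincomb_Y[OF ys(2)]] .
    \<comment> \<open>\<open>C\<^sup>2\<close> comes from comparing \<open>N\<close> with the
      p-norm, the power of \<open>n\<close> from \<open>lp_norm_sq_le\<close>. The reverse estimate
      on flat sequences costs another \<open>C\<^sup>2\<close> and the square of the 2 in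
      \<open>lp_norm_flat_ge\<close>, whence \<open>4 * C ^ 4\<close>.\<close>
    define \<rho> where "\<rho> = C\<^sup>2 * real n powr (2 * u - 1)"
    have "0 < \<rho>" using C(1) by (simp add: \<rho>_def n_def)
    moreover have "(N (lincomb ys a))\<^sup>2 \<le> \<rho> * sq_sum n a" for a
    proof -
      have "(N (lincomb ys a))\<^sup>2 \<le> (C * lp_norm p n a)\<^sup>2" using lp(2) N0 by (rule power_mono)
      also have "\<dots> = C\<^sup>2 * (lp_norm p n a)\<^sup>2" by (rule power_mult_distrib)
      also have "\<dots> \<le> C\<^sup>2 * (real n powr (2 * u - 1) * sq_sum n a)"
        unfolding u_def sq_sum_def using lp_norm_sq_le[OF assms(2) p, of n a]
        by (intro mult_left_mono) (auto simp: n_def)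
      finally show ?thesis by (simp add: \<rho>_def)
    qed
    moreover have "\<rho> * real n \<le> 4 * C ^ 4 * (N (lincomb ys z))\<^sup>2" if "flat n m z" for z
    proof -
      have "real n powr u / 2 \<le> lp_norm p n z"
        unfolding u_def using that p assms(2) by (intro lp_norm_flat_ge) (auto simp: flat_def n_def)
      also have "\<dots> \<le> C * N (lincomb ys z)" by (rule lp)
      finally have "(real n powr u)\<^sup>2 \<le> (2 * (C * N (lincomb ys z)))\<^sup>2"
        by (intro power_mono) auto
      then have "C\<^sup>2 * (real n powr u)\<^sup>2 \<le> C\<^sup>2 * (2 * (C * N (lincomb ys z)))\<^sup>2"
        by (intro mult_left_mono) auto
      moreover have "(real n powr u)\<^sup>2 = real n powr (2 * u - 1) * real n"
        by (simp add: n_def power2_eq_square powr_add[symmetric] powr_diff)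
      ultimately show ?thesis
        by (simp add: \<rho>_def power_mult_distrib power2_eq_square power4_eq_xxxx mult_ac)
    qed
    ultimately show ?thesis using ys by (intro exI[of _ ys] exI[of _ \<rho>]) (auto simp: n_def)
  qed
  define D where "D = (4 * C ^ 4 + 1) * C\<^sub>0\<^sup>2 + 1"
  have "real n powr (2 * u - 1) \<le> C\<^sup>2 * D" if n: "1 \<le> n" for n
  proof -
    have "\<exists>x\<in>Y. norm x = 1 \<and> beyond scl e m x \<and>
        (N (lincomb (ys @ [x]) (\<lambda>_. 1)))\<^sup>2 \<le> D * real (length (ys @ [x]))"
      if bound: "(N (lincomb ys (\<lambda>_. 1)))\<^sup>2 \<le> D * real (length ys)" and Y: "set ys \<subseteq> Y" for ys m
    proof -
      obtain x where "x \<in> Y" "norm x = 1" "beyond scl e m x"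
        "(N (lincomb ys (\<lambda>_. 1) + x))\<^sup>2 \<le> (N (lincomb ys (\<lambda>_. 1)))\<^sup>2 + (4 * C ^ 4 + 1) * C\<^sub>0\<^sup>2 + 1"
        using ex_upper_step[OF _ model lincomb_Y[OF Y]] C(1) by (metis mult_pos_pos zero_less_numeral zero_less_power)
      with bound show ?thesis
        by (intro bexI[of _ x]) (auto simp: lincomb_snoc D_def algebra_simps)
    qed
    then have "\<exists>ys. length ys = n \<and> set ys \<subseteq> Y \<and> (N (lincomb ys (\<lambda>_. 1)))\<^sup>2 \<le> D * real (length ys) \<and>
        (\<forall>a. lp_norm p n a \<le> C * N (lincomb ys a) \<and> N (lincomb ys a) \<le> C * lp_norm p n a)"
      by (intro C(2) n) (simp_all add: lincomb_def N_0)
    then obtain ys where ys: "length ys = n" "set ys \<subseteq> Y" "(N (lincomb ys (\<lambda>_. 1)))\<^sup>2 \<le> D * real n"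
      and lp: "lp_norm p n (\<lambda>_. 1 :: 'k) \<le> C * N (lincomb ys (\<lambda>_. 1))"
      by blast
    have "(real n powr u)\<^sup>2 \<le> (C * N (lincomb ys (\<lambda>_. 1)))\<^sup>2"
      using lp lp_norm_const_1[OF assms(2) n, where 'k = 'k] by (intro power_mono) (auto simp: u_def)
    also have "\<dots> \<le> C\<^sup>2 * (D * real n)"
      unfolding power_mult_distrib using ys(3) by (intro mult_left_mono) auto
    also have "(real n powr u)\<^sup>2 = real n powr (2 * u - 1) * real n"
      using n by (simp add: power2_eq_square powr_add[symmetric] powr_diff)
    finally show ?thesis using n by (simp add: mult.assoc[symmetric])
  qed
  moreover obtain n where "1 \<le> n" "C\<^sup>2 * D < real n powr (2 * u - 1)"
    using ex_powr_gt[of "2 * u - 1" "C\<^sup>2 * D"] u by auto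
  ultimately show False by (meson not_le)
qed

text \<open>Sums along a play now grow at least like the square root of \<open>n\<close>, too fast
  for \<open>p > 2\<close>. On flat sequences only an upper bound of the p-norm is needed, which
  covers infinite \<open>p\<close> and gives \<open>C ^ 4\<close> without the factor 4.\<close>

lemma asymptotic_lp_le_2:
  assumes "asymptotic_lp scl e p" "1 \<le> p"
  shows "p \<le> 2"
proof (rule ccontr)
  assume "\<not> ?thesis"
  then have p: "2 < p" by simp
  obtain C where C: "0 < C"
    "\<And>Q n. Q [] \<Longrightarrow>
      (\<And>ys m. Q ys \<Longrightarrow> set ys \<subseteq> Y \<Longrightarrow> \<exists>x\<in>Y. norm x = 1 \<and> beyond scl e m x \<and> Q (ys @ [x])) \<Longrightarrow> 1 \<le> n \<Longrightarrow>
      \<exists>ys. length ys = n \<and> set ys \<subseteq> Y \<and> Q ys \<and> (\<forall>a. lp_norm p n a \<le> C * N (lincomb ys a) \<and>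
        N (lincomb ys a) \<le> C * lp_norm p n a)"
    by (rule asymptotic_lp_vectors_in_Y[OF assms(1)]) blast
  define u where "u = recip p"
  have u: "u < 1 / 2" unfolding u_def by (rule recip_lt_half[OF p])
  have model: "\<exists>xs \<rho>. 2 * m \<le> length xs \<and> xs \<noteq> [] \<and> set xs \<subseteq> Y \<and> 0 < \<rho> \<and>
      (\<forall>a. \<rho> * sq_sum (length xs) a \<le> (N (lincomb xs a))\<^sup>2) \<and>
      (\<forall>z. flat (length xs) m z \<longrightarrow> (N (lincomb xs z))\<^sup>2 \<le> C ^ 4 * (\<rho> * real (length xs)))" for m
  proof -
    define n where "n = 2 * m + 1"
    have n: "1 \<le> n" by (simp add: n_def)
    obtain ys where ys: "length ys = n" "set ys \<subseteq> Y"
      and lp: "\<And>a. lp_norm p n a \<le> C * N (lincomb ys a)" "\<And>a. N (lincomb ys a) \<le> C * lp_norm p n a"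
      using C(2)[of "\<lambda>_. True" n] ex_unit_beyond by (auto simp: n_def)
    have N0: "0 \<le> N (lincomb ys a)" for a using N_nonneg[OF lincomb_Y[OF ys(2)]] .
    define \<rho> where "\<rho> = real n powr (2 * u - 1) / C\<^sup>2"
    have "0 < \<rho>" using C(1) by (simp add: \<rho>_def n_def)
    moreover have "\<rho> * sq_sum n a \<le> (N (lincomb ys a))\<^sup>2" for a
    proof -
      have "real n powr (2 * u - 1) * sq_sum n a \<le> (lp_norm p n a)\<^sup>2"
        unfolding u_def sq_sum_def by (rule lp_norm_sq_ge[OF p n])
      also have "\<dots> \<le> (C * N (lincomb ys a))\<^sup>2"
        using lp(1) lp_norm_nonneg[OF n] by (rule power_mono)
      finally show ?thesis
        using C(1) by (simp add: \<rho>_def power_mult_distrib divide_le_eq mult.commute)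
    qed
    moreover have "(N (lincomb ys z))\<^sup>2 \<le> C ^ 4 * (\<rho> * real n)" if "flat n m z" for z
    proof -
      have "N (lincomb ys z) \<le> C * lp_norm p n z" by (rule lp)
      also have "\<dots> \<le> C * real n powr u"
        unfolding u_def using that C(1) assms(2) n
        by (intro mult_left_mono lp_norm_le_of_norm_le_1) (auto simp: flat_def)
      finally have "(N (lincomb ys z))\<^sup>2 \<le> (C * real n powr u)\<^sup>2"
        using N0 by (rule power_mono)
      also have "\<dots> = C\<^sup>2 * (real n powr (2 * u - 1) * real n)"
        using n by (simp add: power_mult_distrib power2_eq_square powr_add[symmetric] powr_diff)
      also have "\<dots> = C ^ 4 * (\<rho> * real n)"
        using C(1) by (simp add: \<rho>_def power2_eq_square power4_eq_xxxx)
      finally show ?thesis .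
    qed
    ultimately show ?thesis using ys by (intro exI[of _ ys] exI[of _ \<rho>]) (auto simp: n_def)
  qed
  define b where "b = min (c\<^sub>0\<^sup>2) (c\<^sub>0\<^sup>2 / (4 * C ^ 4))"
  have b: "0 < b" using c\<^sub>0_pos C(1) by (simp add: b_def)
  have "real n powr (1 - 2 * u) \<le> C\<^sup>2 / b" if n: "1 \<le> n" for n
  proof -
    have "\<exists>x\<in>Y. norm x = 1 \<and> beyond scl e m x \<and>
        b * real (length (ys @ [x])) \<le> (N (lincomb (ys @ [x]) (\<lambda>_. 1)))\<^sup>2"
      if bound: "b * real (length ys) \<le> (N (lincomb ys (\<lambda>_. 1)))\<^sup>2" and Y: "set ys \<subseteq> Y" for ys m
    proof -
      obtain x where "x \<in> Y" "norm x = 1" "beyond scl e m x"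
        "(N (lincomb ys (\<lambda>_. 1)))\<^sup>2 + b \<le> (N (lincomb ys (\<lambda>_. 1) + x))\<^sup>2"
        using ex_lower_step[OF _ model lincomb_Y[OF Y]] C(1) unfolding b_def by (metis zero_less_power)
      with bound show ?thesis
        by (intro bexI[of _ x]) (auto simp: lincomb_snoc algebra_simps)
    qed
    then have "\<exists>ys. length ys = n \<and> set ys \<subseteq> Y \<and> b * real (length ys) \<le> (N (lincomb ys (\<lambda>_. 1)))\<^sup>2 \<and>
        (\<forall>a. lp_norm p n a \<le> C * N (lincomb ys a) \<and> N (lincomb ys a) \<le> C * lp_norm p n a)"
      by (intro C(2) n) (simp_all add: lincomb_def N_0)
    then obtain ys where ys: "length ys = n" "set ys \<subseteq> Y" "b * real n \<le> (N (lincomb ys (\<lambda>_. 1)))\<^sup>2"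
      and lp: "N (lincomb ys (\<lambda>_. 1)) \<le> C * lp_norm p n (\<lambda>_. 1 :: 'k)"
      by blast
    have "b * real n \<le> (C * real n powr u)\<^sup>2"
      using lp lp_norm_const_1[OF assms(2) n, where 'k = 'k] ys(3) N_nonneg[OF lincomb_Y[OF ys(2)]]
      by (intro order_trans[OF ys(3)] power_mono) (auto simp: u_def)
    also have "\<dots> = C\<^sup>2 * real n powr (2 * u)"
      by (simp add: power_mult_distrib power2_eq_square powr_add[symmetric])
    finally have "real n \<le> C\<^sup>2 / b * real n powr (2 * u)"
      using b by (simp add: field_simps)
    then show ?thesis using n by (simp add: powr_diff divide_le_eq)
  qed
  moreover obtain n where "1 \<le> n" "C\<^sup>2 / b < real n powr (1 - 2 * u)"
    using ex_powr_gt[of "1 - 2 * u" "C\<^sup>2 / b"] u by auto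
  ultimately show False by (meson not_le)
qed

end

theorem theorem2p10:
  fixes scl :: "'k::{real_normed_field, euclidean_space} \<Rightarrow> 'a::banach \<Rightarrow> 'a"
    and e :: "nat \<Rightarrow> 'a" and p :: ereal and Y :: "'a set"
  assumes "banach_over scl"
    and "1 \<le> p" and "p \<noteq> 2"
    and "asymptotic_lp scl e p"
    and "closed_infdim_subspace scl Y"
  shows "\<not> (\<exists>N. equivalent_norm_on scl Y N \<and> almost_transitive scl Y N)"
proof
  assume "\<exists>N. equivalent_norm_on scl Y N \<and> almost_transitive scl Y N"
  then obtain N c C where "is_norm_on scl Y N" "almost_transitive scl Y N" "0 < c" "0 < C"
    "\<forall>y\<in>Y. c * norm y \<le> N y \<and> N y \<le> C * norm y"
    unfolding equivalent_norm_on_def by blast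
  moreover have "normalized_schauder_basis scl e"
    using assms(4) by (simp add: asymptotic_lp_def)
  ultimately interpret almost_transitive_subspace scl e Y N c C
    using assms(1,5)
    by (auto simp: almost_transitive_subspace_def almost_transitive_subspace_axioms_def
        schauder_space_def schauder_space_axioms_def closed_infdim_subspace_def)
  show False
    using asymptotic_lp_ge_2[OF assms(4,2)] asymptotic_lp_le_2[OF assms(4,2)] assms(3)
    by (meson order_antisym)
qed

end
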